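(* Let $d\geq 1$ be an integer, let $(T_1,\dots,T_d)$ be a tuple of homogeneous trees (whose branching numbers may be different), and let $D$ be a subset of the level product $\bigcup_{n\in\mathbb{N}} T_1(n)\times\cdots\times T_d(n)$ of $(T_1,\dots,T_d)$ satisfying \[ \limsup_{n\to\infty} \frac{|D\cap ( T_1(n)\times \cdots \times T_d(n))|}{|T_1(n)\times \cdots \times T_d(n)|}>0 . \] Then there exist strong subtrees $S_1,\dots,S_d$ of $T_1,\dots,T_d$ respectively (that is, $S_i$ is a strong subtree of $T_i$ for every $i\in\{1,\dots,d\}$), having common level set (that is, $L_{T_1}(S_1)=\cdots=L_{T_d}(S_d)$), such that the level product $\bigcup_{n\in\mathbb{N}} S_1(n)\times\cdots\times S_d(n)$ of $(S_1,\dots,S_d)$ is a subset of $D$.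
   Context: $\mathbb{N}=\{0,1,2,\dots\}$. A tree is a partially ordered set $(T,<)$ such that for every $t\in T$ the set $\{s\in T: s<t\}$ is finite and linearly ordered under $<$; the cardinality of this set is the length $\ell_T(t)$ of $t$ in $T$. For $n\in\mathbb{N}$ the $n$-level of $T$ is $T(n)=\{t\in T:\ell_T(t)=n\}$. The set of immediate successors of $t$ in $T$ is $\{s\in T: t\leq s \text{ and } \ell_T(s)=\ell_T(t)+1\}$. A tree $T$ is uniquely rooted if $|T(0)|=1$. A tree $T$ is homogeneous if it is uniquely rooted and there exists an integer $b\geq 2$ (the branching number of $T$) such that every $t\in T$ has exactly $b$ immediate successors in $T$. A subtree $S$ of a tree $(T,<)$ is a subset of $T$ viewed as a tree with the induced partial order; its levels $S(n)$, lengths and immediate successors are computed in $S$. A subtree $S$ of $T$ is strong if: (a) $S$ is uniquely rooted; (b) there exists an infinite subset $L_T(S)=\{l_0<l_1<\cdots\}$ of $\mathbb{N}$, called the level set of $S$, such that for every $n\in\mathbb{N}$ the $n$-level $S(n)$ of $S$ is a subset of $T(l_n)$; and (c) for every $s\in S$ and every immediate successor $t$ of $s$ in $T$ there exists a unique immediate successor $s'$ of $s$ in $S$ with $t\leq s'$. *)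

theory Defs
  imports "HOL-Analysis.Analysis" "HOL-Library.Infinite_Set" "HOL-Library.FuncSet"
begin

text \<open>
  A tree is a carrier set together with a strict order on the ambient type that is only
  constrained on the carrier. A subset \<open>S\<close> of a tree \<open>(T, lt)\<close> with the induced order is
  therefore \<open>(S, lt)\<close>, and all notions below, applied to \<open>(S, lt)\<close>, are computed in \<open>S\<close>.
\<close>

definition is_tree :: "'a set \<Rightarrow> ('a \<Rightarrow> 'a \<Rightarrow> bool) \<Rightarrow> bool" where
  "is_tree T lt \<longleftrightarrow>
     irreflp_on T lt \<and> transp_on T lt \<and>
     (\<forall>t\<in>T. finite {s \<in> T. lt s t} \<and> totalp_on {s \<in> T. lt s t} lt)"

definition tree_length :: "'a set \<Rightarrow> ('a \<Rightarrow> 'a \<Rightarrow> bool) \<Rightarrow> 'a \<Rightarrow> nat" where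
  "tree_length T lt t = card {s \<in> T. lt s t}"

definition level :: "'a set \<Rightarrow> ('a \<Rightarrow> 'a \<Rightarrow> bool) \<Rightarrow> nat \<Rightarrow> 'a set" where
  "level T lt n = {t \<in> T. tree_length T lt t = n}"

definition imm_succ :: "'a set \<Rightarrow> ('a \<Rightarrow> 'a \<Rightarrow> bool) \<Rightarrow> 'a \<Rightarrow> 'a set" where
  "imm_succ T lt t = {s \<in> T. lt\<^sup>=\<^sup>= t s \<and> tree_length T lt s = tree_length T lt t + 1}"

definition uniquely_rooted :: "'a set \<Rightarrow> ('a \<Rightarrow> 'a \<Rightarrow> bool) \<Rightarrow> bool" where
  "uniquely_rooted T lt \<longleftrightarrow> card (level T lt 0) = 1"

definition homogeneous_tree :: "'a set \<Rightarrow> ('a \<Rightarrow> 'a \<Rightarrow> bool) \<Rightarrow> bool" where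
  "homogeneous_tree T lt \<longleftrightarrow>
     is_tree T lt \<and> uniquely_rooted T lt \<and>
     (\<exists>b\<ge>2. \<forall>t\<in>T. card (imm_succ T lt t) = b)"

text \<open>
  \<open>enumerate L\<close> is the increasing enumeration \<open>l\<^sub>0 < l\<^sub>1 < \<dots>\<close> of the infinite set \<open>L\<close>.
  If every level of \<open>S\<close> is nonempty, as is the case for strong subtrees of homogeneous trees,
  then there is at most one such \<open>L\<close>.
\<close>

definition has_level_set ::
    "'a set \<Rightarrow> ('a \<Rightarrow> 'a \<Rightarrow> bool) \<Rightarrow> 'a set \<Rightarrow> nat set \<Rightarrow> bool" where
  "has_level_set T lt S L \<longleftrightarrow>
     infinite L \<and> (\<forall>n. level S lt n \<subseteq> level T lt (enumerate L n))"

definition strong_subtree :: "'a set \<Rightarrow> ('a \<Rightarrow> 'a \<Rightarrow> bool) \<Rightarrow> 'a set \<Rightarrow> bool" where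
  "strong_subtree T lt S \<longleftrightarrow>
     S \<subseteq> T \<and> uniquely_rooted S lt \<and>
     (\<exists>L. has_level_set T lt S L) \<and>
     (\<forall>s\<in>S. \<forall>t\<in>imm_succ T lt s. \<exists>!s'. s' \<in> imm_succ S lt s \<and> lt\<^sup>=\<^sup>= t s')"

text \<open>
  A \<open>d\<close>-tuple is a function on \<open>{1..d}\<close>, extended by \<open>undefined\<close>.
\<close>

definition level_prod_at ::
    "nat \<Rightarrow> (nat \<Rightarrow> 'a set) \<Rightarrow> (nat \<Rightarrow> 'a \<Rightarrow> 'a \<Rightarrow> bool) \<Rightarrow> nat \<Rightarrow> (nat \<Rightarrow> 'a) set" where
  "level_prod_at d T lt n = (\<Pi>\<^sub>E i\<in>{1..d}. level (T i) (lt i) n)"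

definition level_product ::
    "nat \<Rightarrow> (nat \<Rightarrow> 'a set) \<Rightarrow> (nat \<Rightarrow> 'a \<Rightarrow> 'a \<Rightarrow> bool) \<Rightarrow> (nat \<Rightarrow> 'a) set" where
  "level_product d T lt = (\<Union>n. level_prod_at d T lt n)"

end

theory Submission
  imports Defs
begin

text \<open>
  Fix an ultrafilter \<open>U\<close> along which the density of \<open>D\<close> stays above some \<open>\<epsilon> > 0\<close>. For finite sets \<open>G\<^sub>i\<close>
  of nodes at a common level of \<open>T\<^sub>i\<close>, let \<open>p(G)\<close> be the limit along \<open>U\<close> of the probability that
  independent uniform points of level \<open>N\<close>, one above each node, span a grid contained in \<open>D\<close>. If
  \<open>p(G) > 0\<close>, then for \<open>U\<close>-many \<open>n\<close> one can choose nodes \<open>s\<close> of level \<open>n\<close> above \<open>G\<close> that span a grid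
  inside \<open>D\<close> and satisfy \<open>p(G') > 0\<close> for the set \<open>G'\<close> of all their immediate successors; iterating
  this builds the strong subtrees. To find \<open>s\<close>, average over all choices at level \<open>n\<close>. The martingale
  \<open>p(s)\<close> is almost constant in \<open>n\<close>, so the average of \<open>p(s)\<close> over grids inside \<open>D\<close> is about \<open>p(G)\<^sup>2\<close> or
  more. By Jensen's inequality \<open>p\<close> stays positive when every vertex of \<open>s\<close> is replaced by several
  copies lying in the same cone. Finally, moving the copies into the cones of the different
  immediate successors costs, by Cauchy-Schwarz, at most the square root of an increment from level
  \<open>n\<close> to \<open>n + 1\<close> of a bounded increasing energy, so the cost tends to \<open>0\<close>.
\<close>

section \<open>Finite averages\<close>

text \<open>On an empty or infinite \<open>A\<close> the value is \<open>0\<close>, by the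
  conventions for sums and division, so linearity, monotonicity and swapping hold for every
  \<open>A\<close>.\<close>

definition avg :: "'b set \<Rightarrow> ('b \<Rightarrow> real) \<Rightarrow> real" where
  "avg A f = (\<Sum>x\<in>A. f x) / real (card A)"

lemma avg_cong: "A = B \<Longrightarrow> (\<And>x. x \<in> B \<Longrightarrow> f x = g x) \<Longrightarrow> avg A f = avg B g"
  by (simp add: avg_def)

lemma avg_const: "finite A \<Longrightarrow> A \<noteq> {} \<Longrightarrow> avg A (\<lambda>_. c) = c"
  by (simp add: avg_def)

lemma avg_singleton [simp]: "avg {a} f = f a"
  by (simp add: avg_def)

lemma avg_mono: "(\<And>x. x \<in> A \<Longrightarrow> f x \<le> g x) \<Longrightarrow> avg A f \<le> avg A g"
  by (simp add: avg_def sum_mono divide_right_mono)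

lemma avg_nonneg: "(\<And>x. x \<in> A \<Longrightarrow> 0 \<le> f x) \<Longrightarrow> 0 \<le> avg A f"
  by (simp add: avg_def sum_nonneg)

lemma avg_le_one: "(\<And>x. x \<in> A \<Longrightarrow> f x \<le> 1) \<Longrightarrow> avg A f \<le> 1"
  using sum_bounded_above[of A f 1] by (auto simp: avg_def divide_le_eq)

lemma avg_add: "avg A (\<lambda>x. f x + g x) = avg A f + avg A g"
  by (simp add: avg_def sum.distrib add_divide_distrib)

lemma avg_diff: "avg A (\<lambda>x. f x - g x) = avg A f - avg A g"
  by (simp add: avg_def sum_subtractf diff_divide_distrib)

lemma avg_cmult: "avg A (\<lambda>x. c * f x) = c * avg A f"
  by (simp add: avg_def sum_distrib_left)

lemma avg_sum: "avg A (\<lambda>x. \<Sum>i\<in>J. f i x) = (\<Sum>i\<in>J. avg A (f i))"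
  by (simp add: avg_def sum.swap[of _ A] sum_divide_distrib)

lemma avg_swap: "avg A (\<lambda>x. avg B (f x)) = avg B (\<lambda>y. avg A (\<lambda>x. f x y))"
  unfolding avg_def sum_divide_distrib[symmetric] by (subst sum.swap) (simp add: mult.commute)

lemma avg_abs_le: "\<bar>avg A f\<bar> \<le> avg A (\<lambda>x. \<bar>f x\<bar>)"
  using sum_abs[of f A] by (simp add: avg_def divide_right_mono)

lemma avg_pos_ex: "0 < avg A f \<Longrightarrow> \<exists>x\<in>A. 0 < f x"
  using avg_mono[of A f "\<lambda>_. 0"] by (force simp: avg_def not_less)

lemma avg_reindex:
  assumes "bij_betw h A B"
  shows "avg B f = avg A (\<lambda>x. f (h x))"
  using sum.reindex_bij_betw[OF assms, of f] bij_betw_same_card[OF assms] by (simp add: avg_def)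

lemma avg_tendsto:
  assumes "\<And>x. x \<in> A \<Longrightarrow> ((\<lambda>N. f N x) \<longlongrightarrow> l x) F"
  shows "((\<lambda>N. avg A (f N)) \<longlongrightarrow> avg A l) F"
proof (cases "card A = 0")
  case False
  then show ?thesis unfolding avg_def by (intro tendsto_intros assms) auto
qed (simp add: avg_def)

text \<open>The blocks have equal size, so a uniform point of the union is a uniform block followed
  by a uniform point in it.\<close>

lemma avg_UN:
  assumes "finite B" "\<And>s. s \<in> B \<Longrightarrow> finite (E s)" "\<And>s. s \<in> B \<Longrightarrow> card (E s) = k"
    and "\<And>s s'. s \<in> B \<Longrightarrow> s' \<in> B \<Longrightarrow> s \<noteq> s' \<Longrightarrow> E s \<inter> E s' = {}"
  shows "avg (\<Union>s\<in>B. E s) f = avg B (\<lambda>s. avg (E s) f)"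
proof -
  have "card (\<Union>s\<in>B. E s) = card B * k"
    using assms by (subst card_UN_disjoint) auto
  moreover have "sum f (\<Union>s\<in>B. E s) = (\<Sum>s\<in>B. sum f (E s))"
    using assms by (subst sum.UNION_disjoint) auto
  ultimately show ?thesis
    using assms by (simp add: avg_def sum_divide_distrib mult.commute)
qed

text \<open>For replacing cones of immediate successors by those of their parents, and one successor
  by the average over all of them; there the price \<open>C\<close> depends on branching numbers
  only.\<close>

lemma avg_subset:
  assumes "finite B" "A \<subseteq> B" "A \<noteq> {}" "real (card B) \<le> C * real (card A)"
    and "\<And>x. x \<in> B \<Longrightarrow> 0 \<le> f x"
  shows "avg A f \<le> C * avg B f"
proof -
  have cA: "0 < real (card A)" using assms finite_subset by (auto simp: card_gt_0_iff)
  have cB: "0 < real (card B)" using assms by (auto simp: card_gt_0_iff)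
  have s: "sum f A \<le> sum f B" using assms by (intro sum_mono2) auto
  have "sum f A * real (card B) \<le> sum f B * (C * real (card A))"
    using s assms cB by (intro mult_mono) (auto intro: sum_nonneg)
  then show ?thesis using cA cB by (simp add: avg_def divide_simps mult_ac)
qed

text \<open>Jensen's inequality for a function convex on the nonnegative reals. The exponent is
  positive because on an empty \<open>A\<close> both averages are \<open>0\<close>, while
  \<open>0 ^ 0 = 1\<close>.\<close>

lemma avg_power_le:
  fixes n :: nat
  assumes "n > 0" "\<And>x. x \<in> A \<Longrightarrow> 0 \<le> f x"
  shows "(avg A f) ^ n \<le> avg A (\<lambda>x. f x ^ n)"
proof (cases "finite A \<and> A \<noteq> {}")
  case True
  have "convex_on {0..} (\<lambda>x::real. x ^ n)"
  proof (cases "even n")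
    case True
    then show ?thesis using convex_power_even convex_on_subset by blast
  qed (rule convex_power_odd)
  from convex_on_sum[OF _ _ this, of A "\<lambda>_. 1 / real (card A)" f]
  show ?thesis using True assms by (simp add: avg_def sum_divide_distrib)
next
  case False
  then have "card A = 0" by auto
  then show ?thesis using assms(1) by (simp add: avg_def power_0_left)
qed

lemma avg_square_le: "(avg A f)\<^sup>2 \<le> avg A (\<lambda>x. (f x)\<^sup>2)"
proof -
  have "(avg A f)\<^sup>2 \<le> (avg A (\<lambda>x. \<bar>f x\<bar>))\<^sup>2"
    using avg_abs_le by (metis abs_ge_zero power2_abs power_mono)
  also have "\<dots> \<le> avg A (\<lambda>x. \<bar>f x\<bar>\<^sup>2)" by (rule avg_power_le) auto
  finally show ?thesis by simp
qed

lemma avg_sqrt_le: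
  assumes "\<And>x. x \<in> A \<Longrightarrow> 0 \<le> f x"
  shows "avg A (\<lambda>x. sqrt (f x)) \<le> sqrt (avg A f)"
proof (rule real_le_rsqrt)
  have "(avg A (\<lambda>x. sqrt (f x)))\<^sup>2 \<le> avg A (\<lambda>x. (sqrt (f x))\<^sup>2)" by (rule avg_square_le)
  also have "\<dots> = avg A f" using assms by (intro avg_cong) auto
  finally show "(avg A (\<lambda>x. sqrt (f x)))\<^sup>2 \<le> avg A f" .
qed

lemma avg_variance:
  assumes "finite A" "A \<noteq> {}"
  shows "avg A (\<lambda>x. (f x - avg A f)\<^sup>2) = avg A (\<lambda>x. (f x)\<^sup>2) - (avg A f)\<^sup>2"
proof -
  have "avg A (\<lambda>x. (f x - avg A f)\<^sup>2) = avg A (\<lambda>x. (f x)\<^sup>2 - (2 * avg A f) * f x + (avg A f)\<^sup>2)"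
    by (intro avg_cong) (auto simp: power2_diff)
  also have "\<dots> = avg A (\<lambda>x. (f x)\<^sup>2) - (2 * avg A f) * avg A f + (avg A f)\<^sup>2"
    using assms by (subst avg_add, subst avg_diff, subst avg_cmult) (simp add: avg_const)
  finally show ?thesis by (simp add: power2_eq_square)
qed

lemma avg_PiE_insert:
  assumes "finite J" "v \<notin> J"
  shows "avg (PiE (insert v J) A) f = avg (A v) (\<lambda>y. avg (PiE J A) (\<lambda>x. f (x(v := y))))"
proof -
  have inj: "inj_on (\<lambda>(y, x). x(v := y)) (A v \<times> PiE J A)" using assms by (intro inj_combinator)
  have "sum f (PiE (insert v J) A) = (\<Sum>(y, x)\<in>A v \<times> PiE J A. f (x(v := y)))"
    unfolding PiE_insert_eq by (subst sum.reindex[OF inj]) (auto intro!: sum.cong)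
  also have "\<dots> = (\<Sum>y\<in>A v. \<Sum>x\<in>PiE J A. f (x(v := y)))"
    by (rule sum.cartesian_product[symmetric])
  finally have "sum f (PiE (insert v J) A) = (\<Sum>y\<in>A v. \<Sum>x\<in>PiE J A. f (x(v := y)))" .
  moreover have "card (PiE (insert v J) A) = card (A v) * card (PiE J A)"
    using assms by (simp add: card_PiE)
  ultimately show ?thesis
    unfolding avg_def sum_divide_distrib[symmetric] by (simp add: mult.commute)
qed

lemma avg_PiE_insert':
  assumes "finite J" "v \<notin> J"
  shows "avg (PiE (insert v J) A) f = avg (PiE J A) (\<lambda>x. avg (A v) (\<lambda>y. f (x(v := y))))"
  unfolding avg_PiE_insert[OF assms] by (rule avg_swap)

text \<open>Fubini for a product split into two blocks; \<open>override_on x z K\<close> glues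
  \<open>x\<close> on \<open>R\<close> to \<open>z\<close> on \<open>K\<close>.\<close>

lemma avg_PiE_Un:
  fixes A :: "'b \<Rightarrow> 'c set"
  assumes "finite K" "finite R" "R \<inter> K = {}"
  shows "avg (PiE (R \<union> K) A) f = avg (PiE R A) (\<lambda>x. avg (PiE K A) (\<lambda>z. f (override_on x z K)))"
  using assms(1,3)
proof (induction K arbitrary: f rule: finite_induct)
  case (insert k K)
  have "avg (PiE (R \<union> insert k K) A) f
      = avg (A k) (\<lambda>y. avg (PiE (R \<union> K) A) (\<lambda>x. f (x(k := y))))"
    using insert assms(2) avg_PiE_insert[of "R \<union> K" k A f] by simp
  also have "\<dots> = avg (A k) (\<lambda>y. avg (PiE R A) (\<lambda>x. avg (PiE K A) (\<lambda>z. f ((override_on x z K)(k := y)))))"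
    using insert by simp
  also have "\<dots> = avg (PiE R A) (\<lambda>x. avg (A k) (\<lambda>y. avg (PiE K A) (\<lambda>z. f ((override_on x z K)(k := y)))))"
    by (rule avg_swap)
  also have "\<dots> = avg (PiE R A) (\<lambda>x. avg (PiE (insert k K) A) (\<lambda>z. f (override_on x z (insert k K))))"
  proof -
    have "override_on x (z(k := y)) (insert k K) = (override_on x z K)(k := y)" for x z :: "'b \<Rightarrow> 'c" and y
      using insert by (auto simp: override_on_def)
    then show ?thesis using insert by (simp add: avg_PiE_insert)
  qed
  finally show ?case .
qed simp

text \<open>Independence of identically distributed coordinates; the source of the powers in the
  copy arguments below.\<close>

lemma avg_PiE_prod:
  assumes "finite K"
  shows "avg (PiE K (\<lambda>_. Y)) (\<lambda>z. \<Prod>k\<in>K. g (z k)) = (avg Y g) ^ card K"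
  using assms
proof (induction K rule: finite_induct)
  case (insert k K)
  have "avg (PiE (insert k K) (\<lambda>_. Y)) (\<lambda>z. \<Prod>k\<in>insert k K. g (z k))
      = avg Y (\<lambda>y. avg (PiE K (\<lambda>_. Y)) (\<lambda>z. g y * (\<Prod>k\<in>K. g (z k))))"
    using insert by (auto simp: avg_PiE_insert intro!: avg_cong prod.cong)
  also have "\<dots> = avg Y g * (avg Y g) ^ card K"
    using insert by (simp add: avg_cmult mult.commute[of _ "_ ^ _"])
  finally show ?case using insert by simp
qed simp

text \<open>Each coordinate is drawn in two stages, first \<open>s v\<close> and then a point of
  \<open>E v (s v)\<close>; by Fubini all first stages can precede all second stages.\<close>

lemma avg_PiE_tower:
  assumes "finite J" and "\<And>v g. v \<in> J \<Longrightarrow> avg (A v) g = avg (B v) (\<lambda>t. avg (E v t) g)"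
  shows "avg (PiE J A) f = avg (PiE J B) (\<lambda>s. avg (PiE J (\<lambda>v. E v (s v))) f)"
  using assms
proof (induction J arbitrary: f rule: finite_induct)
  case (insert v J)
  have eq: "PiE J (\<lambda>w. E w (if w = v then t else s w)) = PiE J (\<lambda>w. E w (s w))" for s t
    using insert by (intro PiE_cong) auto
  have "avg (PiE (insert v J) A) f
      = avg (B v) (\<lambda>t. avg (E v t) (\<lambda>y. avg (PiE J B) (\<lambda>s. avg (PiE J (\<lambda>w. E w (s w))) (\<lambda>x. f (x(v := y))))))"
    using insert by (simp add: avg_PiE_insert)
  also have "\<dots> = avg (B v) (\<lambda>t. avg (PiE J B) (\<lambda>s. avg (E v t) (\<lambda>y. avg (PiE J (\<lambda>w. E w (s w))) (\<lambda>x. f (x(v := y))))))"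
    by (subst avg_swap) rule
  also have "\<dots> = avg (PiE (insert v J) B) (\<lambda>s. avg (PiE (insert v J) (\<lambda>v. E v (s v))) f)"
    using insert by (simp add: avg_PiE_insert eq)
  finally show ?case .
qed simp

lemma avg_PiE_marginal:
  assumes "finite K" "finite R" "R \<inter> K = {}" "\<And>k. k \<in> K \<Longrightarrow> finite (A k) \<and> A k \<noteq> {}"
    and "\<And>x z. f (override_on x z K) = f x"
  shows "avg (PiE (R \<union> K) A) f = avg (PiE R A) f"
  using assms by (simp add: avg_PiE_Un avg_const finite_PiE PiE_eq_empty_iff)

section \<open>Ultrafilters and limits along them\<close>

lemma exists_ultrafilter:
  fixes F :: "'b filter"
  assumes "F \<noteq> bot"
  shows "\<exists>U\<le>F. U \<noteq> bot \<and> (\<forall>P. eventually P U \<or> eventually (\<lambda>x. \<not> P x) U)"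
proof -
  let ?A = "{G. G \<noteq> bot \<and> G \<le> F}"
  \<comment> \<open>Zorn's lemma for the reversed order: a minimal nontrivial filter below
    \<open>F\<close> is the ultrafilter sought.\<close>
  have "\<exists>m\<in>?A. \<forall>a\<in>?A. a \<le> m \<longrightarrow> a = m"
  proof (rule predicate_Zorn)
    show "partial_order_on ?A (relation_of (\<lambda>a b. b \<le> a) ?A)"
      by (rule partial_order_on_relation_ofI) auto
  next
    fix C assume C: "C \<in> Chains (relation_of (\<lambda>a b. b \<le> a) ?A)"
    show "\<exists>u\<in>?A. \<forall>a\<in>C. u \<le> a"
    proof (cases "C = {}")
      case True
      then show ?thesis using assms by auto
    next
      case False
      have CA: "C \<subseteq> ?A" and ch: "\<And>a b. a \<in> C \<Longrightarrow> b \<in> C \<Longrightarrow> a \<le> b \<or> b \<le> a"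
        using C by (auto simp: Chains_def relation_of_def)
      have "\<exists>x\<in>C. x \<le> inf G H" if "G \<in> C" "H \<in> C" for G H
        using ch[OF that] that by (auto intro: bexI[of _ G] bexI[of _ H])
      \<comment> \<open>A chain is directed, so an event holds eventually along \<open>Inf C\<close>
        only if it does along some member; hence \<open>Inf C\<close> stays nontrivial.\<close>
      then have "eventually P (Inf C) \<longleftrightarrow> (\<exists>b\<in>C. eventually P b)" for P
        using False by (intro eventually_Inf_base)
      then have "Inf C \<noteq> bot" using CA by (auto simp: eventually_False[symmetric])
      moreover obtain G where "G \<in> C" using False by blast
      then have "Inf C \<le> G" "G \<le> F" using CA by (auto intro: Inf_lower)
      then have "Inf C \<le> F" by (rule order_trans)
      ultimately show ?thesis by (intro bexI[of _ "Inf C"]) (simp_all add: Inf_lower)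
    qed
  qed
  then obtain U where U: "U \<noteq> bot" "U \<le> F" and min: "\<And>a. a \<noteq> bot \<Longrightarrow> a \<le> U \<Longrightarrow> a = U"
    by (auto intro: order_trans)
  have "eventually P U \<or> eventually (\<lambda>x. \<not> P x) U" for P
  proof (cases "inf U (principal {x. P x}) = bot")
    case True
    then have "eventually (\<lambda>_. False) (inf U (principal {x. P x}))" by simp
    then show ?thesis by (auto simp: eventually_inf_principal)
  next
    case False
    then have "inf U (principal {x. P x}) = U" by (intro min) auto
    moreover have "eventually P (inf U (principal {x. P x}))" by (simp add: eventually_inf_principal)
    ultimately show ?thesis by simp
  qed
  with U show ?thesis by blast
qed

text \<open>Compactness of the interval gives a cluster point of the image filter, and along an
  ultrafilter a cluster point is a limit.\<close>

lemma ultrafilter_limit_exists: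
  fixes f :: "'b \<Rightarrow> real"
  assumes U: "U \<noteq> bot" "\<And>P. eventually P U \<or> eventually (\<lambda>x. \<not> P x) U"
    and f: "\<And>n. f n \<in> {a..b}"
  shows "\<exists>l. (f \<longlongrightarrow> l) U"
proof -
  have "filtermap f U \<noteq> bot" using U by (simp add: filtermap_bot_iff)
  moreover have "eventually (\<lambda>x. x \<in> {a..b}) (filtermap f U)"
    using f by (simp add: eventually_filtermap)
  ultimately obtain l where l: "inf (nhds l) (filtermap f U) \<noteq> bot"
    using compact_Icc[of a b] unfolding compact_filter by blast
  have "(f \<longlongrightarrow> l) U"
  proof (rule topological_tendstoI, rule ccontr)
    fix S assume S: "open S" "l \<in> S" "\<not> eventually (\<lambda>x. f x \<in> S) U"
    then have "eventually (\<lambda>x. f x \<notin> S) U" using U(2) by blast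
    then have "eventually (\<lambda>y. y \<notin> S) (filtermap f U)" by (simp add: eventually_filtermap)
    moreover have "eventually (\<lambda>y. y \<in> S) (nhds l)" using S by (simp add: eventually_nhds) blast
    ultimately have "eventually (\<lambda>_. False) (inf (nhds l) (filtermap f U))"
      unfolding eventually_inf by blast
    then show False using l by simp
  qed
  then show ?thesis ..
qed

section \<open>Grid densities in systems of cones\<close>

text \<open>What the density argument uses of trees: \<open>Lv i n\<close> stands for level
  \<open>n\<close> of tree \<open>i\<close>, \<open>cone i t n\<close> for the part of that level
  above \<open>t\<close>, and \<open>child i t\<close> numbers the immediate successors of
  \<open>t\<close>. Equal cone sizes make uniform points of different levels consistent.\<close>

locale cone_system =
  fixes I :: "'i set" and Lv :: "'i \<Rightarrow> nat \<Rightarrow> 'a set" and cone :: "'i \<Rightarrow> 'a \<Rightarrow> nat \<Rightarrow> 'a set"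
    and br :: "'i \<Rightarrow> nat" and child :: "'i \<Rightarrow> 'a \<Rightarrow> nat \<Rightarrow> 'a" and D :: "('i \<Rightarrow> 'a) set"
  assumes finite_I: "finite I"
    and br_pos: "i \<in> I \<Longrightarrow> br i > 0"
    and card_cone: "i \<in> I \<Longrightarrow> t \<in> Lv i m \<Longrightarrow> m \<le> n \<Longrightarrow> card (cone i t n) = br i ^ (n - m)"
    and cone_sub: "i \<in> I \<Longrightarrow> cone i t n \<subseteq> Lv i n"
    and cone_UN: "i \<in> I \<Longrightarrow> t \<in> Lv i m \<Longrightarrow> m \<le> k \<Longrightarrow> k \<le> n \<Longrightarrow> cone i t n = (\<Union>s\<in>cone i t k. cone i s n)"
    and cone_disj: "i \<in> I \<Longrightarrow> s \<in> Lv i k \<Longrightarrow> s' \<in> Lv i k \<Longrightarrow> k \<le> n \<Longrightarrow> s \<noteq> s' \<Longrightarrow>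
      cone i s n \<inter> cone i s' n = {}"
    and cone_refl: "i \<in> I \<Longrightarrow> t \<in> Lv i m \<Longrightarrow> cone i t m = {t}"
    and child_bij: "i \<in> I \<Longrightarrow> t \<in> Lv i m \<Longrightarrow> bij_betw (child i t) {..<br i} (cone i t (Suc m))"
begin

lemma finite_cone: "i \<in> I \<Longrightarrow> t \<in> Lv i m \<Longrightarrow> m \<le> n \<Longrightarrow> finite (cone i t n)"
  using card_cone[of i t m n] br_pos[of i] by (metis card.infinite not_gr0 power_not_zero)

lemma cone_nonempty: "i \<in> I \<Longrightarrow> t \<in> Lv i m \<Longrightarrow> m \<le> n \<Longrightarrow> cone i t n \<noteq> {}"
  using card_cone[of i t m n] br_pos[of i] by force

lemma avg_cone:
  assumes "i \<in> I" "t \<in> Lv i m" "m \<le> k" "k \<le> n"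
  shows "avg (cone i t n) f = avg (cone i t k) (\<lambda>s. avg (cone i s n) f)"
proof -
  have sub: "s \<in> Lv i k" if "s \<in> cone i t k" for s using that assms cone_sub by blast
  have "cone i s n \<inter> cone i s' n = {}" if "s \<in> cone i t k" "s' \<in> cone i t k" "s \<noteq> s'" for s s'
    using that assms cone_disj[of i s k s' n] sub by blast
  moreover have "finite (cone i s n)" "card (cone i s n) = br i ^ (n - k)" if "s \<in> cone i t k" for s
    using that assms sub[of s] by (auto simp: card_cone intro: finite_cone)
  ultimately show ?thesis
    unfolding cone_UN[OF assms]
    using assms finite_cone[of i t m k] by (intro avg_UN) auto
qed

text \<open>Real-valued, so that conjunctions of grid events become products and their probabilities
  averages.\<close>

definition hit :: "('i \<Rightarrow> 'a set) \<Rightarrow> real" where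
  "hit A = of_bool (PiE I A \<subseteq> D)"

lemma hit_bounds: "0 \<le> hit A" "hit A \<le> 1"
  by (auto simp: hit_def)

lemma hit_Un:
  assumes "i \<in> I"
  shows "hit (A(i := Y \<union> Z)) = hit (A(i := Y)) * hit (A(i := Z))"
proof -
  have "PiE I (A(i := Y \<union> Z)) = PiE I (A(i := Y)) \<union> PiE I (A(i := Z))"
    using assms by (auto simp: PiE_iff split: if_splits)
  then show ?thesis by (auto simp: hit_def)
qed

text \<open>The fixed points \<open>Y\<close> are shared by all factors. \<open>K\<close> is
  nonempty because the empty product is \<open>1\<close>, whereas the grid of \<open>Y\<close> alone
  may leave \<open>D\<close>.\<close>

lemma hit_prod:
  assumes "i \<in> I" "finite K" "K \<noteq> {}"
  shows "hit (A(i := Y \<union> z ` K)) = (\<Prod>k\<in>K. hit (A(i := insert (z k) Y)))"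
  using assms(2,3)
proof (induction K rule: finite_ne_induct)
  case (insert k K)
  have "Y \<union> z ` insert k K = insert (z k) Y \<union> (Y \<union> z ` K)" by auto
  then have "hit (A(i := Y \<union> z ` insert k K)) = hit (A(i := insert (z k) Y)) * hit (A(i := Y \<union> z ` K))"
    using hit_Un[OF assms(1), of A "insert (z k) Y" "Y \<union> z ` K"] by (simp only:)
  then show ?case by (simp only: insert.IH prod.insert[OF insert.hyps(1,3)])
qed simp

text \<open>A configuration is a finite set \<open>J\<close> of vertices; the vertex \<open>v\<close> belongs to the tree \<open>c v\<close> and its
  random point ranges over the cone of \<open>a v\<close>.\<close>

definition img :: "('k \<Rightarrow> 'i) \<Rightarrow> 'k set \<Rightarrow> ('k \<Rightarrow> 'a) \<Rightarrow> 'i \<Rightarrow> 'a set" where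
  "img c J x = (\<lambda>i. x ` {v \<in> J. c v = i})"

definition box :: "nat \<Rightarrow> ('k \<Rightarrow> 'i) \<Rightarrow> 'k set \<Rightarrow> ('k \<Rightarrow> 'a) \<Rightarrow> ('k \<Rightarrow> 'a) set" where
  "box N c J a = (\<Pi>\<^sub>E v\<in>J. cone (c v) (a v) N)"

text \<open>Vertices are abstract indices rather than nodes, so that several of them, such as the
  copies of one vertex, may share a node.\<close>

definition dens :: "nat \<Rightarrow> ('k \<Rightarrow> 'i) \<Rightarrow> 'k set \<Rightarrow> ('k \<Rightarrow> 'a) \<Rightarrow> real" where
  "dens N c J a = avg (box N c J a) (\<lambda>x. hit (img c J x))"

lemma box_cong: "(\<And>v. v \<in> J \<Longrightarrow> c v = c' v \<and> a v = a' v) \<Longrightarrow> box N c J a = box N c' J a'"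
  unfolding box_def by (intro PiE_cong) auto

lemma dens_cong:
  assumes "\<And>v. v \<in> J \<Longrightarrow> a v = a' v"
  shows "dens N c J a = dens N c J a'"
  using box_cong[of J c c a a'] assms by (simp add: dens_def)

lemma dens_bounds: "0 \<le> dens N c J a" "dens N c J a \<le> 1"
  by (auto simp: dens_def hit_bounds intro: avg_nonneg avg_le_one)

text \<open>Composition with \<open>h\<close> identifies the two boxes and preserves the spanned
  grid.\<close>

lemma dens_reindex:
  assumes h: "bij_betw h J J'" and c: "\<And>v. v \<in> J \<Longrightarrow> c v = c' (h v)"
  shows "dens N c J (\<lambda>v. a (h v)) = dens N c' J' a"
proof -
  let ?g = "the_inv_into J h"
  have inj: "inj_on h J" and J': "J' = h ` J" using h by (auto simp: bij_betw_def)
  have gh: "?g (h v) = v" if "v \<in> J" for v using that inj by (simp add: the_inv_into_f_f)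
  have hg: "h (?g v) = v" "?g v \<in> J" if "v \<in> J'" for v using that inj J' gh by auto
  have "bij_betw (\<lambda>x. restrict (x \<circ> h) J) (box N c' J' a) (box N c J (\<lambda>v. a (h v)))"
  proof (rule bij_betw_byWitness[where f' = "\<lambda>x. restrict (x \<circ> ?g) J'"])
    show "\<forall>x\<in>box N c' J' a. restrict (restrict (x \<circ> h) J \<circ> ?g) J' = x"
      unfolding box_def by (auto simp: fun_eq_iff restrict_def PiE_iff extensional_def hg)
    show "\<forall>x\<in>box N c J (\<lambda>v. a (h v)). restrict (restrict (x \<circ> ?g) J' \<circ> h) J = x"
      unfolding box_def by (auto simp: fun_eq_iff restrict_def PiE_iff extensional_def gh J')
    show "(\<lambda>x. restrict (x \<circ> h) J) ` box N c' J' a \<subseteq> box N c J (\<lambda>v. a (h v))"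
      unfolding box_def by (auto simp: PiE_iff J' c)
    show "(\<lambda>x. restrict (x \<circ> ?g) J') ` box N c J (\<lambda>v. a (h v)) \<subseteq> box N c' J' a"
      unfolding box_def by (auto simp: PiE_iff J' c gh)
  qed
  moreover have "img c J (restrict (x \<circ> h) J) = img c' J' x" for x
    unfolding img_def J' using c by (auto simp: fun_eq_iff image_iff)
  ultimately show ?thesis by (simp add: dens_def avg_reindex)
qed

text \<open>Given the other points, distinct copies of a vertex are independent, and the grid event is
  the conjunction of the grid events of the single copies; hence the power.\<close>

lemma dens_copies:
  assumes "finite R" "finite K" "K \<noteq> {}" "R \<inter> K = {}" "i \<in> I"
    and K: "\<And>k. k \<in> K \<Longrightarrow> c k = i \<and> a k = t"
  shows "dens N c (R \<union> K) a = avg (box N c R a) (\<lambda>x.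
    (avg (cone i t N) (\<lambda>y. hit ((img c R x)(i := insert y (img c R x i))))) ^ card K)"
proof -
  have "img c (R \<union> K) (override_on x z K) = (img c R x)(i := img c R x i \<union> z ` K)" for x z
  proof
    fix i'
    have R: "override_on x z K ` {v \<in> R. c v = i'} = x ` {v \<in> R. c v = i'}"
      using assms(4) by (intro image_cong) (auto simp: override_on_def)
    have K': "override_on x z K ` {v \<in> K. c v = i'} = (if i' = i then z ` K else {})"
      using K by (auto simp: override_on_def)
    have "{v \<in> R \<union> K. c v = i'} = {v \<in> R. c v = i'} \<union> {v \<in> K. c v = i'}" by auto
    then show "img c (R \<union> K) (override_on x z K) i' = ((img c R x)(i := img c R x i \<union> z ` K)) i'"
      unfolding img_def using R K' by (simp add: image_Un)
  qed
  moreover have "(\<Pi>\<^sub>E v\<in>K. cone (c v) (a v) N) = (\<Pi>\<^sub>E v\<in>K. cone i t N)"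
    using K by (intro PiE_cong) auto
  ultimately show ?thesis
    using assms
      avg_PiE_prod[OF assms(2), of "cone i t N" "\<lambda>y. hit ((img c R x)(i := insert y (img c R x i)))" for x]
    by (simp add: dens_def box_def avg_PiE_Un hit_prod)
qed

text \<open>The grid event splits into the event that the points of \<open>R\<close> span a grid
  inside \<open>D\<close> and the event behind \<open>\<psi> x y\<close>, in which \<open>y\<close>
  is the only point of its tree. Only the second changes when \<open>u\<close> moves, and it ignores
  all other points in the tree of \<open>u\<close>. Cauchy-Schwarz bounds the change by an L2
  distance.\<close>

lemma dens_move:
  assumes "finite J" "u \<in> J" "c u \<in> I"
  defines "R \<equiv> J - {u}"
  defines "\<psi> \<equiv> \<lambda>x y. hit ((img c R x)(c u := {y}))"
  shows "\<bar>dens N c J (a(u := t)) - dens N c J a\<bar> \<le> sqrt (avg (box N c R a) (\<lambda>x.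
    (avg (cone (c u) t N) (\<psi> x) - avg (cone (c u) (a u) N) (\<psi> x))\<^sup>2))"
proof -
  let ?d = "\<lambda>x. avg (cone (c u) t N) (\<psi> x) - avg (cone (c u) (a u) N) (\<psi> x)"
  have J: "J = insert u R" "u \<notin> R" "finite R" using assms by auto
  have img: "hit (img c J (x(u := y))) = hit (img c R x) * \<psi> x y" for x y
  proof -
    have "img c J (x(u := y)) = (img c R x)(c u := img c R x (c u) \<union> {y})"
      using J by (auto simp: fun_eq_iff img_def image_iff)
    then show ?thesis using hit_Un[OF assms(3), of "img c R x" "img c R x (c u)" "{y}"]
      by (simp add: \<psi>_def)
  qed
  have boxR: "box N c R (a(u := s)) = box N c R a" for s
    using J by (intro box_cong) auto
  have eq: "dens N c J b = avg (box N c R b) (\<lambda>x. hit (img c R x) * avg (cone (c u) (b u) N) (\<psi> x))" for b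
    using J(2,3) unfolding dens_def box_def
    by (subst J(1), subst avg_PiE_insert') (auto simp: img avg_cmult simp flip: J(1))
  have "dens N c J (a(u := t)) - dens N c J a = avg (box N c R a) (\<lambda>x. hit (img c R x) * ?d x)"
    unfolding eq boxR by (simp add: avg_diff[symmetric] right_diff_distrib)
  then have "\<bar>dens N c J (a(u := t)) - dens N c J a\<bar>\<^sup>2 \<le> avg (box N c R a) (\<lambda>x. (hit (img c R x) * ?d x)\<^sup>2)"
    by (simp add: avg_square_le)
  also have "\<dots> \<le> avg (box N c R a) (\<lambda>x. (?d x)\<^sup>2)"
  proof (rule avg_mono)
    fix x
    have "(hit (img c R x))\<^sup>2 \<le> 1" using hit_bounds[of "img c R x"] by (simp add: power_le_one)
    then show "(hit (img c R x) * ?d x)\<^sup>2 \<le> (?d x)\<^sup>2"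
      by (simp add: power_mult_distrib mult_left_le_one_le)
  qed
  finally show ?thesis by (rule real_le_rsqrt)
qed

end

section \<open>Limit densities of configurations\<close>

locale cone_limit = cone_system I Lv cone br child D
  for I :: "'i set" and Lv and cone :: "'i \<Rightarrow> 'a \<Rightarrow> nat \<Rightarrow> 'a set" and br child D +
  fixes U :: "nat filter"
  assumes U_sequentially: "U \<le> sequentially" and U_nontrivial: "U \<noteq> bot"
    and U_ultra: "eventually P U \<or> eventually (\<lambda>x. \<not> P x) U"
begin

definition ldens :: "('k \<Rightarrow> 'i) \<Rightarrow> 'k set \<Rightarrow> ('k \<Rightarrow> 'a) \<Rightarrow> real" where
  "ldens c J a = Lim U (\<lambda>N. dens N c J a)"

lemma ldens_tendsto: "((\<lambda>N. dens N c J a) \<longlongrightarrow> ldens c J a) U"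
proof -
  have "\<exists>l. ((\<lambda>N. dens N c J a) \<longlongrightarrow> l) U"
    using U_nontrivial U_ultra
    by (rule ultrafilter_limit_exists[where a = 0 and b = 1]) (auto simp: dens_bounds)
  then show ?thesis unfolding ldens_def using tendsto_Lim U_nontrivial by blast
qed

lemma ldens_bounds: "0 \<le> ldens c J a" "ldens c J a \<le> 1"
  using U_nontrivial
  by (auto intro!: tendsto_lowerbound[OF ldens_tendsto] tendsto_upperbound[OF ldens_tendsto]
      simp: dens_bounds)

lemma ldens_cong: "(\<And>v. v \<in> J \<Longrightarrow> a v = a' v) \<Longrightarrow> ldens c J a = ldens c J a'"
  unfolding ldens_def using dens_cong[of J a a'] by simp

lemma ldens_reindex:
  assumes "bij_betw h J J'" "\<And>v. v \<in> J \<Longrightarrow> c v = c' (h v)"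
  shows "ldens c J (\<lambda>v. a (h v)) = ldens c' J' a"
  unfolding ldens_def using dens_reindex[of h J J' c c' _ a] assms by simp

lemma eventually_ge: "eventually (\<lambda>N. n \<le> N) U"
  using U_sequentially eventually_ge_at_top filter_leD by blast

end

section \<open>Blow-ups: several copies of each vertex\<close>

locale blowup = cone_limit I Lv cone br child D U
  for I :: "'i set" and Lv and cone :: "'i \<Rightarrow> 'a \<Rightarrow> nat \<Rightarrow> 'a set" and br child D U +
  fixes V :: "'v set" and c :: "'v \<Rightarrow> 'i"
  assumes finite_V: "finite V" and c_in: "v \<in> V \<Longrightarrow> c v \<in> I"
begin

text \<open>The pair \<open>(v, j)\<close> is copy number \<open>j\<close> of \<open>v\<close>, with
  its random point in the same cone; an empty \<open>K v\<close> deletes \<open>v\<close>.\<close>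

definition blow_dens :: "('v \<Rightarrow> nat set) \<Rightarrow> nat \<Rightarrow> ('v \<Rightarrow> 'a) \<Rightarrow> real" where
  "blow_dens K N s = dens N (c \<circ> fst) (Sigma V K) (s \<circ> fst)"

definition rest :: "('v \<Rightarrow> nat set) \<Rightarrow> nat \<Rightarrow> ('v \<Rightarrow> 'a) \<Rightarrow> 'v \<Rightarrow> ('v \<times> nat \<Rightarrow> 'a) set" where
  "rest K N s v = box N (c \<circ> fst) (Sigma (V - {v}) K) (s \<circ> fst)"

text \<open>The conditional probability, given the points \<open>x\<close> of all other vertices,
  that a single copy of \<open>v\<close> based at \<open>t\<close> completes them to a grid inside
  \<open>D\<close>.\<close>

definition fibre :: "('v \<Rightarrow> nat set) \<Rightarrow> nat \<Rightarrow> 'v \<Rightarrow> 'a \<Rightarrow> ('v \<times> nat \<Rightarrow> 'a) \<Rightarrow> real" where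
  "fibre K N v t x = avg (cone (c v) t N) (\<lambda>y. hit ((img (c \<circ> fst) (Sigma (V - {v}) K) x)
     (c v := insert y (img (c \<circ> fst) (Sigma (V - {v}) K) x (c v)))))"

lemma blow_dens_bounds: "0 \<le> blow_dens K N s" "blow_dens K N s \<le> 1"
  by (simp_all add: blow_dens_def dens_bounds)

lemma fibre_nonneg: "0 \<le> fibre K N v t x"
  by (simp add: fibre_def avg_nonneg hit_bounds)

lemma rest_upd [simp]: "rest K N (s(v := t)) v = rest K N s v"
  unfolding rest_def by (intro box_cong) auto

lemma blow_dens_eq:
  assumes "\<And>w. w \<in> V \<Longrightarrow> finite (K w)" "v \<in> V" "K v \<noteq> {}"
  shows "blow_dens K N s = avg (rest K N s v) (\<lambda>x. fibre K N v (s v) x ^ card (K v))"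
proof -
  have S: "Sigma V K = Sigma (V - {v}) K \<union> {v} \<times> K v" using assms by auto
  have card: "card (K v) = card ({v} \<times> K v)" by (simp add: card_cartesian_product)
  show ?thesis
    unfolding blow_dens_def fibre_def rest_def S card
    using assms finite_V c_in by (intro dens_copies) auto
qed

lemma avg_fibre:
  assumes "v \<in> V" "s v \<in> Lv (c v) m" "m \<le> k" "k \<le> N"
  shows "fibre K N v (s v) x = avg (cone (c v) (s v) k) (\<lambda>t. fibre K N v t x)"
  unfolding fibre_def using assms c_in by (intro avg_cone) auto

text \<open>The fibre density averages out under refinement, so by Jensen its power can only grow on
  average: a submartingale in the position of \<open>v\<close>.\<close>

lemma blow_dens_refine:
  assumes K: "\<And>w. w \<in> V \<Longrightarrow> finite (K w)" and v: "v \<in> V" "s v \<in> Lv (c v) m" "m \<le> k" "k \<le> N"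
  shows "blow_dens K N s \<le> avg (cone (c v) (s v) k) (\<lambda>t. blow_dens K N (s(v := t)))"
proof (cases "K v = {}")
  case True
  have "blow_dens K N (s(v := t)) = blow_dens K N s" for t
    unfolding blow_dens_def using True by (intro dens_cong) auto
  then show ?thesis using v c_in finite_cone[of "c v"] cone_nonempty[of "c v"] by (simp add: avg_const)
next
  case False
  then have n: "card (K v) > 0" using K v by (simp add: card_gt_0_iff)
  have "blow_dens K N s = avg (rest K N s v) (\<lambda>x. (avg (cone (c v) (s v) k) (\<lambda>t. fibre K N v t x)) ^ card (K v))"
    using blow_dens_eq[of K v, OF K v(1) False] avg_fibre[of v s m k N] v by simp
  also have "\<dots> \<le> avg (rest K N s v) (\<lambda>x. avg (cone (c v) (s v) k) (\<lambda>t. fibre K N v t x ^ card (K v)))"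
    by (intro avg_mono avg_power_le n fibre_nonneg)
  also have "\<dots> = avg (cone (c v) (s v) k) (\<lambda>t. avg (rest K N s v) (\<lambda>x. fibre K N v t x ^ card (K v)))"
    by (rule avg_swap)
  also have "\<dots> = avg (cone (c v) (s v) k) (\<lambda>t. blow_dens K N (s(v := t)))"
    using blow_dens_eq[of K v, OF K v(1) False] by simp
  finally show ?thesis .
qed

text \<open>With two copies the density is the mean square of the fibre density, and the increment
  of a second moment under refinement is a variance.\<close>

lemma blow_dens_variance:
  assumes K: "\<And>w. w \<in> V \<Longrightarrow> finite (K w)" and v: "v \<in> V" "s v \<in> Lv (c v) m" "m \<le> k" "k \<le> N"
    and 2: "card (K v) = 2"
  shows "avg (cone (c v) (s v) k) (\<lambda>t. avg (rest K N s v) (\<lambda>x. (fibre K N v t x - fibre K N v (s v) x)\<^sup>2))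
    = avg (cone (c v) (s v) k) (\<lambda>t. blow_dens K N (s(v := t))) - blow_dens K N s"
proof -
  have ne: "K v \<noteq> {}" using 2 by auto
  let ?B = "cone (c v) (s v) k"
  have "avg ?B (\<lambda>t. (fibre K N v t x - fibre K N v (s v) x)\<^sup>2)
      = avg ?B (\<lambda>t. (fibre K N v t x)\<^sup>2) - (fibre K N v (s v) x)\<^sup>2" for x
    unfolding avg_fibre[of v s m k N K x, OF v]
    using v c_in finite_cone[of "c v"] cone_nonempty[of "c v"] by (intro avg_variance) auto
  then have "avg ?B (\<lambda>t. avg (rest K N s v) (\<lambda>x. (fibre K N v t x - fibre K N v (s v) x)\<^sup>2))
      = avg (rest K N s v) (\<lambda>x. avg ?B (\<lambda>t. (fibre K N v t x)\<^sup>2)) - avg (rest K N s v) (\<lambda>x. (fibre K N v (s v) x)\<^sup>2)"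
    by (subst avg_swap) (simp add: avg_diff)
  also have "\<dots> = avg ?B (\<lambda>t. avg (rest K N s v) (\<lambda>x. (fibre K N v t x)\<^sup>2)) - avg (rest K N s v) (\<lambda>x. (fibre K N v (s v) x)\<^sup>2)"
    by (subst avg_swap) rule
  finally show ?thesis
    using blow_dens_eq[of K v, OF K v(1) ne] 2 by simp
qed

text \<open>One copy gives the mean of the fibre density, \<open>card B\<close> copies the mean of
  its power; Jensen compares them.\<close>

lemma blow_dens_copy:
  assumes K: "\<And>w. w \<in> V \<Longrightarrow> finite (K w)" and v: "v \<in> V" and "card (K v) = 1" "finite B" "B \<noteq> {}"
  shows "blow_dens K N s ^ card B \<le> blow_dens (K(v := B)) N s"
proof -
  have ne: "K v \<noteq> {}" using assms by auto
  have S: "Sigma (V - {v}) (K(v := B)) = Sigma (V - {v}) K" by auto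
  have "blow_dens K N s ^ card B = (avg (rest K N s v) (fibre K N v (s v))) ^ card B"
    using blow_dens_eq[of K v, OF K v ne] assms by simp
  also have "\<dots> \<le> avg (rest K N s v) (\<lambda>x. fibre K N v (s v) x ^ card B)"
    using assms by (intro avg_power_le fibre_nonneg) (simp add: card_gt_0_iff)
  also have "\<dots> = blow_dens (K(v := B)) N s"
    using blow_dens_eq[of "K(v := B)" v N s] assms by (simp add: rest_def fibre_def S)
  finally show ?thesis .
qed

end

lemma (in cone_system) box_tower:
  assumes "finite J" "\<And>v. v \<in> J \<Longrightarrow> c v \<in> I \<and> a v \<in> Lv (c v) m" "m \<le> n" "n \<le> N"
  shows "avg (box N c J a) f = avg (box n c J a) (\<lambda>s. avg (box N c J s) f)"
  unfolding box_def using assms(1) by (rule avg_PiE_tower) (rule avg_cone, use assms in auto)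

lemma (in cone_system) box_finite:
  assumes "finite J" "\<And>v. v \<in> J \<Longrightarrow> c v \<in> I \<and> a v \<in> Lv (c v) m" "m \<le> n"
  shows "finite (box n c J a)" "box n c J a \<noteq> {}"
proof -
  have "finite (cone (c v) (a v) n)" "cone (c v) (a v) n \<noteq> {}" if "v \<in> J" for v
    using assms that finite_cone[of "c v" "a v" m n] cone_nonempty[of "c v" "a v" m n] by auto
  then show "finite (box n c J a)" "box n c J a \<noteq> {}"
    unfolding box_def using assms(1) by (auto intro!: finite_PiE simp: PiE_eq_empty_iff)
qed

lemma (in cone_system) box_level:
  "s \<in> box n c J a \<Longrightarrow> v \<in> J \<Longrightarrow> c v \<in> I \<Longrightarrow> s v \<in> Lv (c v) n"
  unfolding box_def using cone_sub by blast

section \<open>Moving copies into the cones of immediate successors\<close>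

context blowup
begin

definition K_single :: "'v \<Rightarrow> nat set" where "K_single v = {0}"

text \<open>One copy per immediate successor, to be moved later into the cones of distinct
  successors.\<close>

definition K_full :: "'v \<Rightarrow> nat set" where "K_full v = {..<br (c v)}"

text \<open>Two copies of \<open>v\<close>, and none of the other vertices of its tree: by \<open>blow_dens_variance\<close>, refining the
  cone of \<open>v\<close> increases this density by the squared distance that controls a move of a copy of \<open>v\<close>.\<close>

definition K_energy :: "'v \<Rightarrow> 'v \<Rightarrow> nat set" where
  "K_energy v w = (if w = v then {..<2} else if c w = c v then {} else K_full w)"

lemma finite_K [simp]: "finite (K_single v)" "finite (K_full v)" "finite (K_energy w v)"
  by (auto simp: K_single_def K_full_def K_energy_def)

lemma blow_dens_one: "blow_dens K_single N s = dens N c V s"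
proof -
  have "bij_betw fst (Sigma V K_single) V" by (auto simp: bij_betw_def inj_on_def K_single_def image_iff)
  from dens_reindex[OF this, of "c \<circ> fst" c N s] show ?thesis by (simp add: blow_dens_def comp_def)
qed

text \<open>Vertices are blown up one after the other by \<open>blow_dens_copy\<close>, each
  contributing its branching number as a factor of \<open>B\<close>. The exponent is uniform in
  \<open>N\<close> and \<open>s\<close>, so the bound survives the limit.\<close>

lemma blow_dens_full: "\<exists>B>0. \<forall>N s. blow_dens K_single N s ^ B \<le> blow_dens K_full N s"
proof -
  have "\<exists>B>0. \<forall>N s. blow_dens K_single N s ^ B \<le> blow_dens (\<lambda>w. if w \<in> W then K_full w else {0}) N s"
    if "finite W" "W \<subseteq> V" for W
    using that
  proof (induction W rule: finite_induct)
    case empty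
    then show ?case by (intro exI[of _ 1]) (simp add: K_single_def cong: if_cong)
  next
    case (insert v W)
    let ?K = "\<lambda>w. if w \<in> W then K_full w else {0}"
    obtain B where B: "B > 0" "\<And>N s. blow_dens K_single N s ^ B \<le> blow_dens ?K N s" using insert by auto
    have v: "v \<in> V" and b: "br (c v) > 0" using insert c_in br_pos by auto
    have upd: "?K(v := K_full v) = (\<lambda>w. if w \<in> insert v W then K_full w else {0})"
      by (auto simp: fun_eq_iff)
    have "blow_dens K_single N s ^ (B * br (c v)) \<le> blow_dens (\<lambda>w. if w \<in> insert v W then K_full w else {0}) N s" for N s
    proof -
      have "blow_dens K_single N s ^ (B * br (c v)) = (blow_dens K_single N s ^ B) ^ br (c v)" by (rule power_mult)
      also have "\<dots> \<le> blow_dens ?K N s ^ card (K_full v)"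
        using B(2) by (simp add: K_full_def power_mono blow_dens_bounds)
      also have "\<dots> \<le> blow_dens (?K(v := K_full v)) N s"
        using insert v b by (intro blow_dens_copy) (auto simp: K_full_def)
      finally show ?thesis unfolding upd .
    qed
    then show ?case using B b by (intro exI[of _ "B * br (c v)"]) auto
  qed
  from this[OF finite_V] obtain B where "B > 0"
    "\<And>N s. blow_dens K_single N s ^ B \<le> blow_dens (\<lambda>w. if w \<in> V then K_full w else {0}) N s" by auto
  moreover have "Sigma V (\<lambda>w. if w \<in> V then K_full w else {0}) = Sigma V K_full" by auto
  ultimately show ?thesis unfolding blow_dens_def by auto
qed

text \<open>Interpolates between all copies at their own nodes, for empty \<open>W\<close>, and all
  copies at successors; copy number \<open>j\<close> moves to successor number
  \<open>j\<close>.\<close>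

definition move_copies :: "('v \<Rightarrow> 'a) \<Rightarrow> ('v \<times> nat) set \<Rightarrow> 'v \<times> nat \<Rightarrow> 'a" where
  "move_copies s W u = (if u \<in> W then child (c (fst u)) (s (fst u)) (snd u) else s (fst u))"

definition refine_gain :: "nat \<Rightarrow> nat \<Rightarrow> 'v \<Rightarrow> ('v \<Rightarrow> 'a) \<Rightarrow> real" where
  "refine_gain N n v s = avg (cone (c v) (s v) (Suc n)) (\<lambda>t. blow_dens (K_energy v) N (s(v := t))) - blow_dens (K_energy v) N s"

text \<open>The product pays for enlarging the cones of moved copies to those of their nodes, the
  last factor for replacing one successor by the average over all.\<close>

definition move_const :: "'v \<times> nat \<Rightarrow> real" where
  "move_const u = (\<Prod>w\<in>Sigma V K_full. real (br (c (fst w)))) * real (br (c (fst u)))"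

text \<open>\<open>dens_move\<close> bounds the change by a mean squared difference between the
  fibre densities at a successor and at its parent. The integrand ignores the tree of
  \<open>u\<close>, so the mean can be brought to the configuration \<open>K_energy\<close>, where
  averaging over the successors turns it into a variance, the gain in energy.\<close>

lemma dens_move_copies_step:
  assumes s: "\<And>v. v \<in> V \<Longrightarrow> s v \<in> Lv (c v) n" and N: "Suc n \<le> N"
    and W: "W \<subseteq> Sigma V K_full" and u: "u \<in> Sigma V K_full" "u \<notin> W"
  shows "\<bar>dens N (c \<circ> fst) (Sigma V K_full) (move_copies s (insert u W)) - dens N (c \<circ> fst) (Sigma V K_full) (move_copies s W)\<bar>
    \<le> sqrt (move_const u * refine_gain N n (fst u) s)"
proof -
  define J where "J = Sigma V K_full"
  define R where "R = J - {u}"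
  define v where "v = fst u"
  define c' where "c' = c \<circ> (fst :: 'v \<times> nat \<Rightarrow> 'v)"
  define S where "S = Sigma (V - {v}) (K_energy v)"
  define t where "t = child (c v) (s v) (snd u)"
  define \<psi> where "\<psi> = (\<lambda>x y. hit ((img c' R x)(c v := {y})))"
  define F where "F = (\<lambda>x. (avg (cone (c v) t N) (\<psi> x) - avg (cone (c v) (s v) N) (\<psi> x))\<^sup>2)"
  have v: "v \<in> V" "snd u < br (c v)" and cv: "c v \<in> I" using u c_in by (auto simp: v_def K_full_def)
  have finJ: "finite J" "finite R" using finite_V by (auto simp: J_def R_def)
  have J: "c' w \<in> I \<and> (s \<circ> fst) w \<in> Lv (c' w) n" "0 < br (c' w)" "snd w < br (c' w)" "fst w \<in> V"
    if "w \<in> J" for w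
    using that s c_in br_pos by (auto simp: J_def c'_def K_full_def)
  have child: "child (c' w) (s (fst w)) (snd w) \<in> cone (c' w) (s (fst w)) (Suc n)" if "w \<in> J" for w
    using child_bij[of "c' w" "s (fst w)" n] J[OF that] by (auto simp: bij_betw_def)
  have t: "t \<in> cone (c v) (s v) (Suc n)" using child[of u] u by (simp add: J_def t_def v_def c'_def)
  \<comment> \<open>A moved copy ranges over a part of the parent cone of relative size one over the
    branching number, an unmoved one over all of it.\<close>
  have move_copies_cone: "cone (c' w) (move_copies s W w) N \<subseteq> cone (c' w) ((s \<circ> fst) w) N"
    and move_copies_card: "card (cone (c' w) ((s \<circ> fst) w) N) \<le> br (c' w) * card (cone (c' w) (move_copies s W w) N)"
    and move_copies_ne: "cone (c' w) (move_copies s W w) N \<noteq> {}" if w: "w \<in> J" for w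
  proof -
    let ?i = "c' w" and ?s = "s (fst w)" and ?t = "child (c' w) (s (fst w)) (snd w)"
    have i: "?i \<in> I" "?s \<in> Lv ?i n" using J[OF w] by auto
    have tc: "?t \<in> cone ?i ?s (Suc n)" by (rule child[OF w])
    then have t: "?t \<in> Lv ?i (Suc n)" using cone_sub i by blast
    have sub: "cone ?i ?t N \<subseteq> cone ?i ?s N" using cone_UN[OF i, of "Suc n" N] tc N by auto
    have move_copies: "move_copies s W w = (if w \<in> W then ?t else ?s)" by (simp add: move_copies_def c'_def)
    have "br ?i ^ (N - n) = br ?i * br ?i ^ (N - Suc n)" using N by (metis Suc_diff_Suc Suc_le_lessD power_Suc)
    then have "card (cone ?i ?s N) = br ?i * card (cone ?i ?t N)"
      using card_cone[OF i, of N] card_cone[OF i(1) t, of N] N by simp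
    then show "card (cone ?i ((s \<circ> fst) w) N) \<le> br ?i * card (cone ?i (move_copies s W w) N)"
      using J(2)[OF w] by (auto simp: move_copies)
    show "cone ?i (move_copies s W w) N \<subseteq> cone ?i ((s \<circ> fst) w) N" using sub by (auto simp: move_copies)
    show "cone ?i (move_copies s W w) N \<noteq> {}"
      using cone_nonempty[OF i, of N] cone_nonempty[OF i(1) t, of N] N by (auto simp: move_copies)
  qed
  have upd: "move_copies s (insert u W) = (move_copies s W)(u := t)" by (auto simp: move_copies_def t_def v_def)
  have "\<bar>dens N c' J ((move_copies s W)(u := t)) - dens N c' J (move_copies s W)\<bar> \<le> sqrt (avg (box N c' R (move_copies s W)) F)"
    using dens_move[of J u c' N "move_copies s W" t] finJ u cv
    by (simp add: J_def[symmetric] R_def[symmetric] F_def \<psi>_def c'_def v_def move_copies_def)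
  also have "\<dots> \<le> sqrt (move_const u * refine_gain N n v s)"
  proof (rule real_sqrt_le_mono)
    have RJ: "w \<in> J" if "w \<in> R" for w using that by (simp add: R_def)
    have 1: "avg (box N c' R (move_copies s W)) F \<le> (\<Prod>w\<in>J. real (br (c' w))) * avg (box N c' R (s \<circ> fst)) F"
    proof (rule avg_subset)
      show "finite (box N c' R (s \<circ> fst))"
        using box_finite(1)[of R c' "s \<circ> fst" n N] J RJ finJ N by auto
      show "box N c' R (move_copies s W) \<subseteq> box N c' R (s \<circ> fst)"
        unfolding box_def using move_copies_cone RJ by (intro PiE_mono) auto
      show "box N c' R (move_copies s W) \<noteq> {}"
        unfolding box_def using move_copies_ne RJ by (auto simp: PiE_eq_empty_iff)
      have "(\<Prod>w\<in>R. card (cone (c' w) ((s \<circ> fst) w) N)) \<le> (\<Prod>w\<in>R. br (c' w) * card (cone (c' w) (move_copies s W w) N))"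
        using move_copies_card RJ by (intro prod_mono) auto
      also have "\<dots> = (\<Prod>w\<in>R. br (c' w)) * (\<Prod>w\<in>R. card (cone (c' w) (move_copies s W w) N))" by (rule prod.distrib)
      also have "\<dots> \<le> (\<Prod>w\<in>J. br (c' w)) * (\<Prod>w\<in>R. card (cone (c' w) (move_copies s W w) N))"
      proof (rule mult_right_mono)
        have "J = insert u R" "u \<notin> R" using u by (auto simp: R_def J_def)
        then show "(\<Prod>w\<in>R. br (c' w)) \<le> (\<Prod>w\<in>J. br (c' w))"
          using finJ J(2)[of u] u by (simp add: J_def)
      qed simp
      finally have "card (box N c' R (s \<circ> fst)) \<le> (\<Prod>w\<in>J. br (c' w)) * card (box N c' R (move_copies s W))"
        using finJ by (simp add: box_def card_PiE)
      then show "real (card (box N c' R (s \<circ> fst))) \<le> (\<Prod>w\<in>J. real (br (c' w))) * real (card (box N c' R (move_copies s W)))"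
        by (metis of_nat_le_iff of_nat_mult of_nat_prod)
      show "0 \<le> F x" for x by (simp add: F_def)
    qed
    \<comment> \<open>The integrand sees only the points in trees other than \<open>c v\<close>,
      whose copies make up \<open>S\<close>; the other coordinates are integrated out.\<close>
    have "avg (box N c' R (s \<circ> fst)) F = avg (box N c' S (s \<circ> fst)) F"
    proof -
      have SR: "S \<union> (R - S) = R" "S \<subseteq> J"
        using u by (auto simp: S_def R_def J_def K_energy_def v_def split: if_splits)
      have "F (override_on x z (R - S)) = F x" for x z
      proof -
        have "w \<in> S" if "w \<in> R" "c' w \<noteq> c v" for w
          using that by (auto simp: S_def R_def J_def K_energy_def c'_def v_def)
        then have "(img c' R (override_on x z (R - S)))(c v := {y}) = (img c' R x)(c v := {y})" for y
          by (auto simp: fun_eq_iff img_def override_on_def image_iff)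
        then show ?thesis by (simp add: F_def \<psi>_def)
      qed
      moreover have "finite (cone (c' k) ((s \<circ> fst) k) N) \<and> cone (c' k) ((s \<circ> fst) k) N \<noteq> {}" if "k \<in> R - S" for k
        using that J[of k] RJ N finite_cone[of "c' k" _ n N] cone_nonempty[of "c' k" _ n N] by auto
      ultimately have "avg (\<Pi>\<^sub>E v\<in>S \<union> (R - S). cone (c' v) ((s \<circ> fst) v) N) F = avg (\<Pi>\<^sub>E v\<in>S. cone (c' v) ((s \<circ> fst) v) N) F"
        using finJ SR finite_subset[of S J] by (intro avg_PiE_marginal) auto
      then show ?thesis unfolding SR box_def .
    qed
    \<comment> \<open>\<open>S\<close> has no vertex in the tree \<open>c v\<close>, so
      \<open>y\<close> is inserted into the empty set and \<open>\<psi>\<close> agrees with the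
      integrand of \<open>fibre\<close>.\<close>
    also have "\<dots> = avg (rest (K_energy v) N s v) (\<lambda>x. (fibre (K_energy v) N v t x - fibre (K_energy v) N v (s v) x)\<^sup>2)"
    proof -
      have "(img c' R x)(c v := {y}) = (img c' S x)(c v := insert y (img c' S x (c v)))" for x y
      proof
        fix i
        have "{w \<in> R. c' w = i} = {w \<in> S. c' w = i}" if "i \<noteq> c v"
          using that u by (auto simp: S_def R_def J_def K_energy_def c'_def v_def split: if_splits)
        moreover have "{w \<in> S. c' w = c v} = {}"
          by (auto simp: S_def K_energy_def c'_def split: if_splits)
        ultimately show "((img c' R x)(c v := {y})) i = ((img c' S x)(c v := insert y (img c' S x (c v)))) i"
          unfolding img_def by auto
      qed
      then show ?thesis by (simp add: F_def \<psi>_def fibre_def rest_def S_def c'_def)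
    qed
    also have "\<dots> \<le> real (br (c v)) * refine_gain N n v s"
    proof -
      let ?G = "\<lambda>t. avg (rest (K_energy v) N s v) (\<lambda>x. (fibre (K_energy v) N v t x - fibre (K_energy v) N v (s v) x)\<^sup>2)"
      let ?B = "cone (c v) (s v) (Suc n)"
      have "card ?B = br (c v)" "finite ?B"
        using card_cone[OF cv s[OF v(1)], of "Suc n"] finite_cone[OF cv s[OF v(1)], of "Suc n"] by auto
      \<comment> \<open>\<open>t\<close> is one of \<open>br (c v)\<close> successors, and the
        average over all of them is the variance.\<close>
      then have "avg {t} ?G \<le> real (br (c v)) * avg ?B ?G"
        using t by (intro avg_subset) (auto intro: avg_nonneg)
      also have "avg ?B ?G = refine_gain N n v s"
        unfolding refine_gain_def using v s[OF v(1)] N by (intro blow_dens_variance) (auto simp: K_energy_def)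
      finally show ?thesis by simp
    qed
    finally have 2: "avg (box N c' R (s \<circ> fst)) F \<le> real (br (c v)) * refine_gain N n v s" .
    have "move_const u = (\<Prod>w\<in>J. real (br (c' w))) * real (br (c v))"
      by (simp add: move_const_def J_def c'_def v_def)
    then show "avg (box N c' R (move_copies s W)) F \<le> move_const u * refine_gain N n v s"
      using 1 mult_left_mono[OF 2, of "\<Prod>w\<in>J. real (br (c' w))"] by (simp add: prod_nonneg mult.assoc)
  qed
  finally show ?thesis unfolding upd J_def c'_def v_def .
qed

text \<open>The copies are moved one at a time and the costs added up.\<close>

lemma dens_move_copies:
  assumes s: "\<And>v. v \<in> V \<Longrightarrow> s v \<in> Lv (c v) n" and N: "Suc n \<le> N"
  shows "\<bar>dens N (c \<circ> fst) (Sigma V K_full) (move_copies s (Sigma V K_full)) - blow_dens K_full N s\<bar>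
    \<le> (\<Sum>u\<in>Sigma V K_full. sqrt (move_const u * refine_gain N n (fst u) s))"
proof -
  define c' where "c' = c \<circ> (fst :: 'v \<times> nat \<Rightarrow> 'v)"
  have "\<bar>dens N c' (Sigma V K_full) (move_copies s W) - blow_dens K_full N s\<bar>
    \<le> (\<Sum>u\<in>W. sqrt (move_const u * refine_gain N n (fst u) s))" if "finite W" "W \<subseteq> Sigma V K_full" for W
    using that
  proof (induction W rule: finite_induct)
    case empty
    have move_copies: "move_copies s {} = s \<circ> fst" by (auto simp: move_copies_def)
    show ?case unfolding move_copies blow_dens_def c'_def by (simp only: diff_self abs_zero sum.empty order_refl)
  next
    case (insert u W)
    then show ?case using dens_move_copies_step[OF s N, of W u] unfolding c'_def[symmetric] by auto
  qed
  then show ?thesis unfolding c'_def using finite_V by auto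
qed

end

section \<open>Limits along an ultrafilter\<close>

lemma eventually_mono_bounded_tendsto:
  fixes f :: "nat \<Rightarrow> real"
  assumes "\<And>n. n \<ge> m \<Longrightarrow> f n \<le> f (Suc n)" "\<And>n. f n \<le> b"
  shows "\<exists>L. f \<longlonglongrightarrow> L \<and> (\<forall>n\<ge>m. f n \<le> L)"
proof -
  have inc: "incseq (\<lambda>n. f (n + m))" using assms(1) by (intro incseq_SucI) auto
  obtain L where L: "(\<lambda>n. f (n + m)) \<longlonglongrightarrow> L" "\<And>n. f (n + m) \<le> L"
    using incseq_convergent[OF inc, of b] assms(2) by blast
  have "f n \<le> L" if "n \<ge> m" for n using L(2)[of "n - m"] that by simp
  then show ?thesis using LIMSEQ_offset[OF L(1)] by blast
qed

context blowup
begin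

definition blow_ldens :: "('v \<Rightarrow> nat set) \<Rightarrow> ('v \<Rightarrow> 'a) \<Rightarrow> real" where
  "blow_ldens K s = ldens (c \<circ> fst) (Sigma V K) (s \<circ> fst)"

definition lrefine_gain :: "nat \<Rightarrow> 'v \<Rightarrow> ('v \<Rightarrow> 'a) \<Rightarrow> real" where
  "lrefine_gain n v s = avg (cone (c v) (s v) (Suc n)) (\<lambda>t. blow_ldens (K_energy v) (s(v := t))) - blow_ldens (K_energy v) s"

text \<open>The quantity p(G') of the outline: the vertices are now all immediate successors of the
  chosen nodes \<open>s\<close>.\<close>

definition next_ldens :: "('v \<Rightarrow> 'a) \<Rightarrow> real" where
  "next_ldens s = ldens (c \<circ> fst) (Sigma V K_full) (\<lambda>u. child (c (fst u)) (s (fst u)) (snd u))"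

lemma blow_ldens_tendsto: "((\<lambda>N. blow_dens K N s) \<longlongrightarrow> blow_ldens K s) U"
  unfolding blow_dens_def blow_ldens_def by (rule ldens_tendsto)

lemma blow_ldens_bounds: "0 \<le> blow_ldens K s" "blow_ldens K s \<le> 1"
  by (simp_all add: blow_ldens_def ldens_bounds)

lemma blow_ldens_cong: "(\<And>v. v \<in> V \<Longrightarrow> s v = s' v) \<Longrightarrow> blow_ldens K s = blow_ldens K s'"
  unfolding blow_ldens_def by (intro ldens_cong) auto

lemma blow_ldens_refine:
  assumes "\<And>w. w \<in> V \<Longrightarrow> finite (K w)" "v \<in> V" "s v \<in> Lv (c v) m" "m \<le> k"
  shows "blow_ldens K s \<le> avg (cone (c v) (s v) k) (\<lambda>t. blow_ldens K (s(v := t)))"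
proof (rule tendsto_le[OF U_nontrivial _ blow_ldens_tendsto])
  show "((\<lambda>N. avg (cone (c v) (s v) k) (\<lambda>t. blow_dens K N (s(v := t)))) \<longlongrightarrow>
      avg (cone (c v) (s v) k) (\<lambda>t. blow_ldens K (s(v := t)))) U"
    by (intro avg_tendsto blow_ldens_tendsto)
  show "\<forall>\<^sub>F N in U. blow_dens K N s \<le> avg (cone (c v) (s v) k) (\<lambda>t. blow_dens K N (s(v := t)))"
    using eventually_ge[of k] by eventually_elim (use assms in \<open>auto intro: blow_dens_refine\<close>)
qed

lemma blow_ldens_full: "\<exists>B>0. \<forall>s. ldens c V s ^ B \<le> blow_ldens K_full s"
proof -
  obtain B where B: "B > 0" "\<And>N s. blow_dens K_single N s ^ B \<le> blow_dens K_full N s" using blow_dens_full by auto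
  have "ldens c V s ^ B \<le> blow_ldens K_full s" for s
    using B(2) by (intro tendsto_le[OF U_nontrivial blow_ldens_tendsto tendsto_power[OF ldens_tendsto]])
      (auto simp: blow_dens_one)
  with B show ?thesis by blast
qed

lemma lrefine_gain_nonneg:
  assumes "v \<in> V" "s v \<in> Lv (c v) n"
  shows "0 \<le> lrefine_gain n v s"
  using blow_ldens_refine[of "K_energy v" v s n "Suc n"] assms by (simp add: lrefine_gain_def)

lemma move_const_nonneg: "0 \<le> move_const u"
  by (simp add: move_const_def prod_nonneg)

text \<open>The limit of \<open>dens_move_copies\<close>: once all copies sit at their successors,
  they form the configuration of the next stage.\<close>

lemma next_ldens_lower:
  assumes s: "\<And>v. v \<in> V \<Longrightarrow> s v \<in> Lv (c v) n"
  shows "blow_ldens K_full s - (\<Sum>u\<in>Sigma V K_full. sqrt (move_const u * lrefine_gain n (fst u) s)) \<le> next_ldens s"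
proof -
  have next_eq: "ldens (c \<circ> fst) (Sigma V K_full) (move_copies s (Sigma V K_full)) = next_ldens s"
    unfolding next_ldens_def by (intro ldens_cong) (auto simp: move_copies_def)
  have var: "((\<lambda>N. refine_gain N n v s) \<longlongrightarrow> lrefine_gain n v s) U" for v
    unfolding refine_gain_def lrefine_gain_def by (intro tendsto_diff avg_tendsto blow_ldens_tendsto)
  have 1: "((\<lambda>N. blow_dens K_full N s - (\<Sum>u\<in>Sigma V K_full. sqrt (move_const u * refine_gain N n (fst u) s))) \<longlongrightarrow>
      blow_ldens K_full s - (\<Sum>u\<in>Sigma V K_full. sqrt (move_const u * lrefine_gain n (fst u) s))) U"
    by (intro tendsto_diff blow_ldens_tendsto tendsto_sum tendsto_real_sqrt tendsto_mult tendsto_const var)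
  have 2: "((\<lambda>N. dens N (c \<circ> fst) (Sigma V K_full) (move_copies s (Sigma V K_full))) \<longlongrightarrow> next_ldens s) U"
    using ldens_tendsto[of "c \<circ> fst" "Sigma V K_full" "move_copies s (Sigma V K_full)"] by (simp only: next_eq)
  have 3: "\<forall>\<^sub>F N in U. blow_dens K_full N s - (\<Sum>u\<in>Sigma V K_full. sqrt (move_const u * refine_gain N n (fst u) s))
      \<le> dens N (c \<circ> fst) (Sigma V K_full) (move_copies s (Sigma V K_full))"
    using eventually_ge[of "Suc n"]
  proof eventually_elim
    case (elim N)
    have "\<bar>dens N (c \<circ> fst) (Sigma V K_full) (move_copies s (Sigma V K_full)) - blow_dens K_full N s\<bar>
        \<le> (\<Sum>u\<in>Sigma V K_full. sqrt (move_const u * refine_gain N n (fst u) s))"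
      using s elim by (rule dens_move_copies)
    then show ?case unfolding abs_le_iff by linarith
  qed
  show ?thesis by (rule tendsto_le[OF U_nontrivial 2 1 3])
qed

text \<open>For each \<open>N >= n\<close> this is the tower property of boxes, and the average
  commutes with the limit. It makes \<open>ldens\<close> a martingale in the level.\<close>

lemma ldens_tower:
  assumes s: "\<And>v. v \<in> V \<Longrightarrow> s v \<in> Lv (c v) m" and "m \<le> n"
  shows "avg (box n c V s) (ldens c V) = ldens c V s"
proof -
  have "((\<lambda>N. avg (box n c V s) (\<lambda>s'. dens N c V s')) \<longlongrightarrow> avg (box n c V s) (ldens c V)) U"
    by (intro avg_tendsto ldens_tendsto)
  moreover have "\<forall>\<^sub>F N in U. avg (box n c V s) (\<lambda>s'. dens N c V s') = dens N c V s"
    using eventually_ge[of n]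
  proof eventually_elim
    case (elim N)
    have "avg (box N c V s) (\<lambda>x. hit (img c V x)) = avg (box n c V s) (\<lambda>s'. avg (box N c V s') (\<lambda>x. hit (img c V x)))"
      using finite_V c_in s assms(2) elim by (intro box_tower) auto
    then show ?case unfolding dens_def by (rule sym)
  qed
  ultimately have "((\<lambda>N. dens N c V s) \<longlongrightarrow> avg (box n c V s) (ldens c V)) U"
    by (rule Lim_transform_eventually)
  then show ?thesis by (rule tendsto_unique[OF U_nontrivial _ ldens_tendsto])
qed

text \<open>The vertices of \<open>W\<close> are refined one at a time by
  \<open>blow_ldens_refine\<close>. The exceptional vertex \<open>w\<close> may already sit at the
  next level, as happens in \<open>blow_ldens_submartingale_upd\<close>.\<close>

lemma blow_ldens_submartingale:
  assumes s: "\<And>v. v \<in> V \<Longrightarrow> s v \<in> Lv (c v) n \<or> v = w" and W: "finite W" "W \<subseteq> V - {w}"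
    and K: "\<And>w. w \<in> V \<Longrightarrow> finite (K w)"
  shows "blow_ldens K s \<le> avg (box (Suc n) c W s) (\<lambda>s'. blow_ldens K (override_on s s' W))"
  using W
proof (induction W rule: finite_induct)
  case empty
  then show ?case by (simp add: box_def)
next
  case (insert v W)
  have v: "v \<in> V" "s v \<in> Lv (c v) n" using insert s by auto
  have "blow_ldens K s \<le> avg (box (Suc n) c W s) (\<lambda>s'. blow_ldens K (override_on s s' W))" using insert by auto
  also have "\<dots> \<le> avg (box (Suc n) c W s) (\<lambda>s'. avg (cone (c v) (s v) (Suc n))
      (\<lambda>t. blow_ldens K ((override_on s s' W)(v := t))))"
  proof (rule avg_mono)
    fix s'
    have "override_on s s' W v = s v" using insert by simp
    then show "blow_ldens K (override_on s s' W) \<le> avg (cone (c v) (s v) (Suc n)) (\<lambda>t. blow_ldens K ((override_on s s' W)(v := t)))"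
      using blow_ldens_refine[of K v "override_on s s' W" n "Suc n"] K v by simp
  qed
  also have "\<dots> = avg (box (Suc n) c (insert v W) s) (\<lambda>s'. blow_ldens K (override_on s s' (insert v W)))"
  proof -
    have "override_on s (s'(v := t)) (insert v W) = (override_on s s' W)(v := t)" for s' t
      using insert by (auto simp: override_on_def)
    then show ?thesis unfolding box_def using insert by (simp add: avg_PiE_insert')
  qed
  finally show ?case .
qed

text \<open>Refining \<open>v\<close> first and the other vertices afterwards refines all of them,
  and the second stage loses nothing on average. So the gain from \<open>v\<close> alone is at most
  the gain of the whole energy.\<close>

lemma blow_ldens_submartingale_upd:
  assumes s: "\<And>v. v \<in> V \<Longrightarrow> s v \<in> Lv (c v) n" and v: "v \<in> V"
    and K: "\<And>w. w \<in> V \<Longrightarrow> finite (K w)"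
  shows "avg (cone (c v) (s v) (Suc n)) (\<lambda>t. blow_ldens K (s(v := t))) \<le> avg (box (Suc n) c V s) (blow_ldens K)"
proof -
  let ?W = "V - {v}"
  have V: "V = insert v ?W" and W: "finite ?W" "v \<notin> ?W" using v finite_V by auto
  have "avg (cone (c v) (s v) (Suc n)) (\<lambda>t. blow_ldens K (s(v := t)))
      \<le> avg (cone (c v) (s v) (Suc n)) (\<lambda>t. avg (box (Suc n) c ?W s) (\<lambda>s'. blow_ldens K (s'(v := t))))"
  proof (rule avg_mono)
    fix t
    have "blow_ldens K (s(v := t)) \<le> avg (box (Suc n) c ?W (s(v := t))) (\<lambda>s'. blow_ldens K (override_on (s(v := t)) s' ?W))"
      by (rule blow_ldens_submartingale) (use s W K in auto)
    also have "box (Suc n) c ?W (s(v := t)) = box (Suc n) c ?W s" by (intro box_cong) auto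
    also have "(\<lambda>s'. blow_ldens K (override_on (s(v := t)) s' ?W)) = (\<lambda>s'. blow_ldens K (s'(v := t)))"
      by (intro ext blow_ldens_cong) (auto simp: override_on_def)
    finally show "blow_ldens K (s(v := t)) \<le> avg (box (Suc n) c ?W s) (\<lambda>s'. blow_ldens K (s'(v := t)))" .
  qed
  also have "\<dots> = avg (box (Suc n) c V s) (blow_ldens K)"
    unfolding box_def using avg_PiE_insert[OF W, of "\<lambda>v. cone (c v) (s v) (Suc n)" "blow_ldens K"] V by simp
  finally show ?thesis .
qed

section \<open>Averages over random nodes above a fixed configuration\<close>

context
  fixes r m0
  assumes r: "v \<in> V \<Longrightarrow> r v \<in> Lv (c v) m0"
begin

lemma base_tower:
  assumes "m0 \<le> m" "m \<le> n"
  shows "avg (box n c V r) f = avg (box m c V r) (\<lambda>s. avg (box n c V s) f)"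
  using assms finite_V r c_in by (intro box_tower) auto

lemma base_level: "s \<in> box n c V r \<Longrightarrow> v \<in> V \<Longrightarrow> s v \<in> Lv (c v) n"
  using c_in by (intro box_level[of s n c V r v])

text \<open>The mean energies increase from \<open>m0\<close> on and are bounded by
  \<open>1\<close>; the mean gain is squeezed between \<open>0\<close> and their increments.\<close>

lemma avg_lrefine_gain_tendsto_0:
  assumes v: "v \<in> V"
  shows "(\<lambda>n. avg (box n c V r) (lrefine_gain n v)) \<longlonglongrightarrow> 0"
proof -
  let ?E = "\<lambda>n. avg (box n c V r) (blow_ldens (K_energy v))"
  have le: "avg (box n c V r) (lrefine_gain n v) \<le> ?E (Suc n) - ?E n" if "m0 \<le> n" for n
  proof -
    have "avg (box n c V r) (lrefine_gain n v)
        \<le> avg (box n c V r) (\<lambda>s. avg (box (Suc n) c V s) (blow_ldens (K_energy v)) - blow_ldens (K_energy v) s)"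
      unfolding lrefine_gain_def
      by (intro avg_mono diff_right_mono blow_ldens_submartingale_upd) (auto simp: base_level v)
    also have "\<dots> = ?E (Suc n) - ?E n"
      unfolding avg_diff base_tower[OF that le_SucI[OF order_refl], symmetric] ..
    finally show ?thesis .
  qed
  have nonneg: "0 \<le> avg (box n c V r) (lrefine_gain n v)" for n
    by (intro avg_nonneg lrefine_gain_nonneg) (auto simp: base_level v)
  have inc: "?E n \<le> ?E (Suc n)" if "n \<ge> m0" for n using le[OF that] nonneg[of n] by simp
  have bd: "?E n \<le> 1" for n by (intro avg_le_one blow_ldens_bounds)
  obtain L where L: "?E \<longlonglongrightarrow> L"
    using eventually_mono_bounded_tendsto[of m0 ?E 1, OF inc bd] by auto
  have lim: "(\<lambda>n. ?E (Suc n) - ?E n) \<longlonglongrightarrow> L - L" by (intro tendsto_diff LIMSEQ_Suc L)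
  have 1: "\<forall>\<^sub>F n in sequentially. 0 \<le> avg (box n c V r) (lrefine_gain n v)"
    using nonneg by (rule always_eventually[OF allI])
  have 2: "\<forall>\<^sub>F n in sequentially. avg (box n c V r) (lrefine_gain n v) \<le> ?E (Suc n) - ?E n"
    using le by (rule eventually_sequentiallyI)
  show ?thesis using tendsto_sandwich[OF 1 2 tendsto_const] lim by (simp only: diff_self)
qed

text \<open>The mean square of the martingale \<open>ldens\<close> converges, so after a late level
  \<open>m\<close> it hardly moves. With \<open>m\<close> fixed and \<open>n\<close> moving along
  \<open>U\<close>, the frequency of hits above a choice \<open>s\<close> at level \<open>m\<close>
  tends to \<open>ldens c V s\<close>; the average is thus nearly the mean square of
  \<open>ldens\<close> at level \<open>m\<close>, which is at least its squared mean.\<close>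

lemma avg_hit_ldens_lower:
  assumes "\<epsilon> > 0"
  shows "\<forall>\<^sub>F n in U. (ldens c V r)\<^sup>2 - \<epsilon> \<le> avg (box n c V r) (\<lambda>s. hit (img c V s) * ldens c V s)"
proof -
  let ?p = "ldens c V"
  let ?e = "\<lambda>n. avg (box n c V r) (\<lambda>s. (?p s)\<^sup>2)"
  \<comment> \<open>Orthogonality of martingale increments: the mean squared displacement between
    two levels is the difference of the mean squares.\<close>
  have var: "avg (box m c V r) (\<lambda>s. avg (box n c V s) (\<lambda>s'. (?p s' - ?p s)\<^sup>2)) = ?e n - ?e m"
    if "m0 \<le> m" "m \<le> n" for m n
  proof -
    have "avg (box n c V s) (\<lambda>s'. (?p s' - ?p s)\<^sup>2) = avg (box n c V s) (\<lambda>s'. (?p s')\<^sup>2) - (?p s)\<^sup>2"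
      if s: "s \<in> box m c V r" for s
    proof -
      have "s v \<in> Lv (c v) m" if "v \<in> V" for v by (rule base_level[OF s that])
      then show ?thesis
        using avg_variance[of "box n c V s" ?p] ldens_tower[of s m n] box_finite[of V c s m n]
          finite_V c_in \<open>m \<le> n\<close> by auto
    qed
    then have "avg (box m c V r) (\<lambda>s. avg (box n c V s) (\<lambda>s'. (?p s' - ?p s)\<^sup>2))
        = avg (box m c V r) (\<lambda>s. avg (box n c V s) (\<lambda>s'. (?p s')\<^sup>2) - (?p s)\<^sup>2)"
      by (intro avg_cong) auto
    also have "\<dots> = ?e n - ?e m" unfolding avg_diff base_tower[OF that, symmetric] ..
    finally show ?thesis .
  qed
  have mono: "?e m \<le> ?e n" if "m0 \<le> m" "m \<le> n" for m n
  proof -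
    have "0 \<le> avg (box m c V r) (\<lambda>s. avg (box n c V s) (\<lambda>s'. (?p s' - ?p s)\<^sup>2))"
      by (intro avg_nonneg) auto
    then show ?thesis using var[OF that] by simp
  qed
  have bd: "?e n \<le> 1" for n
    by (intro avg_le_one) (auto simp: ldens_bounds power_le_one)
  have inc: "?e n \<le> ?e (Suc n)" if "m0 \<le> n" for n using mono[of n "Suc n"] that by simp
  obtain L where L: "?e \<longlonglongrightarrow> L" and eL: "\<forall>n\<ge>m0. ?e n \<le> L"
    using eventually_mono_bounded_tendsto[of m0 ?e 1, OF inc bd] by auto
  \<comment> \<open>The tolerance is \<open>(\<epsilon> / 2)\<^sup>2\<close> because the mean
    displacement is bounded by the root of the mean squared one; the other
    \<open>\<epsilon> / 2\<close> pays for the limit along \<open>U\<close>.\<close>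
  then have "\<forall>\<^sub>F n in sequentially. dist (?e n) L < (\<epsilon> / 2)\<^sup>2"
    using assms by (intro tendstoD) auto
  then obtain m1 where m1: "\<And>n. n \<ge> m1 \<Longrightarrow> dist (?e n) L < (\<epsilon> / 2)\<^sup>2"
    by (auto simp: eventually_sequentially)
  define m where "m = max m0 m1"
  have m: "m0 \<le> m" by (simp add: m_def)
  have close: "?e n - ?e m \<le> (\<epsilon> / 2)\<^sup>2" if "m \<le> n" for n
    using eL[rule_format, of n] m1[of m] that by (simp add: m_def dist_real_def)
  have "((\<lambda>n. avg (box m c V r) (\<lambda>s. ?p s * dens n c V s) - \<epsilon> / 2) \<longlongrightarrow>
      avg (box m c V r) (\<lambda>s. ?p s * ?p s) - \<epsilon> / 2) U"
    by (intro tendsto_intros avg_tendsto ldens_tendsto)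
  moreover have "(?p r)\<^sup>2 - \<epsilon> < avg (box m c V r) (\<lambda>s. ?p s * ?p s) - \<epsilon> / 2"
    using avg_square_le[of "box m c V r" ?p] ldens_tower[of r m0 m] r m assms
    by (simp add: power2_eq_square)
  ultimately have "\<forall>\<^sub>F n in U. (?p r)\<^sup>2 - \<epsilon> < avg (box m c V r) (\<lambda>s. ?p s * dens n c V s) - \<epsilon> / 2"
    by (rule order_tendstoD)
  then show ?thesis
    using eventually_ge[of m]
  proof eventually_elim
    case (elim n)
    let ?d = "\<lambda>s. avg (box n c V s) (\<lambda>s'. \<bar>?p s' - ?p s\<bar>)"
    have "(avg (box m c V r) ?d)\<^sup>2 \<le> avg (box m c V r) (\<lambda>s. (?d s)\<^sup>2)" by (rule avg_square_le)
    also have "\<dots> \<le> avg (box m c V r) (\<lambda>s. avg (box n c V s) (\<lambda>s'. \<bar>?p s' - ?p s\<bar>\<^sup>2))"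
      by (intro avg_mono avg_square_le)
    also have "\<dots> \<le> (\<epsilon> / 2)\<^sup>2" using var[OF m elim(2)] close[OF elim(2)] by simp
    finally have d: "avg (box m c V r) ?d \<le> \<epsilon> / 2" by (rule power2_le_imp_le) (use assms in simp)
    have "avg (box m c V r) (\<lambda>s. ?p s * dens n c V s) - avg (box m c V r) ?d
        = avg (box m c V r) (\<lambda>s. avg (box n c V s) (\<lambda>s'. ?p s * hit (img c V s') - \<bar>?p s' - ?p s\<bar>))"
      by (simp add: dens_def avg_diff avg_cmult)
    \<comment> \<open>A hit has weight \<open>0\<close> or \<open>1\<close>, so replacing
      \<open>?p s\<close> by \<open>?p s'\<close> costs at most the displacement.\<close>
    also have "\<dots> \<le> avg (box m c V r) (\<lambda>s. avg (box n c V s) (\<lambda>s'. hit (img c V s') * ?p s'))"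
      by (intro avg_mono) (auto simp: hit_def)
    also have "\<dots> = avg (box n c V r) (\<lambda>s. hit (img c V s) * ?p s)"
      by (rule base_tower[OF m elim(2), symmetric])
    finally show ?case using d elim(1) by simp
  qed
qed

text \<open>Jensen raises the lower bound for hits weighted by \<open>ldens\<close> to the power
  \<open>B\<close>. At a hit, the blow-up bound and then the moving bound compare that power with
  \<open>next_ldens\<close>. The mean moving cost is eventually smaller than the bound, so some hit
  keeps a positive next density.\<close>

theorem density_step:
  assumes pos: "ldens c V r > 0"
  shows "\<forall>\<^sub>F n in U. \<exists>s\<in>box n c V r. hit (img c V s) > 0 \<and> next_ldens s > 0"
proof -
  let ?p = "ldens c V" and ?J = "Sigma V K_full"
  let ?\<phi> = "\<lambda>s. hit (img c V s)"
  let ?err = "\<lambda>n. \<Sum>u\<in>?J. sqrt (move_const u * avg (box n c V r) (lrefine_gain n (fst u)))"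
  \<comment> \<open>\<open>avg_hit_ldens_lower\<close> with error \<delta> leaves exactly
    \<delta>.\<close>
  define \<delta> where "\<delta> = (?p r)\<^sup>2 / 2"
  have \<delta>: "\<delta> > 0" using pos by (simp add: \<delta>_def)
  obtain B where B: "B > 0" "\<And>s. ?p s ^ B \<le> blow_ldens K_full s" using blow_ldens_full by auto
  have "?err \<longlonglongrightarrow> (\<Sum>u\<in>?J. sqrt (move_const u * 0))"
    by (intro tendsto_intros avg_lrefine_gain_tendsto_0) auto
  then have "\<forall>\<^sub>F n in sequentially. ?err n < \<delta> ^ B"
    using \<delta> by (intro order_tendstoD) auto
  then have "\<forall>\<^sub>F n in U. ?err n < \<delta> ^ B" using U_sequentially filter_leD by blast
  moreover have "\<forall>\<^sub>F n in U. \<delta> \<le> avg (box n c V r) (\<lambda>s. ?\<phi> s * ?p s)"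
    using avg_hit_ldens_lower[OF \<delta>] by (simp add: \<delta>_def)
  ultimately show ?thesis
  proof eventually_elim
    case (elim n)
    let ?O = "box n c V r"
    have lv: "s v \<in> Lv (c v) n" if "s \<in> ?O" "v \<in> V" for s v by (rule base_level[OF that])
    have "\<delta> ^ B \<le> (avg ?O (\<lambda>s. ?\<phi> s * ?p s)) ^ B" using elim(2) \<delta> by (intro power_mono) auto
    also have "\<dots> \<le> avg ?O (\<lambda>s. (?\<phi> s * ?p s) ^ B)"
      using B(1) by (intro avg_power_le) (auto simp: ldens_bounds hit_bounds)
    also have "\<dots> \<le> avg ?O (\<lambda>s. ?\<phi> s * next_ldens s + (\<Sum>u\<in>?J. sqrt (move_const u * lrefine_gain n (fst u) s)))"
    proof (rule avg_mono)
      fix s assume s: "s \<in> ?O"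
      have nn: "0 \<le> (\<Sum>u\<in>?J. sqrt (move_const u * lrefine_gain n (fst u) s))"
        using lv[OF s] by (intro sum_nonneg) (auto simp: move_const_nonneg intro!: mult_nonneg_nonneg lrefine_gain_nonneg)
      show "(?\<phi> s * ?p s) ^ B \<le> ?\<phi> s * next_ldens s + (\<Sum>u\<in>?J. sqrt (move_const u * lrefine_gain n (fst u) s))"
      proof (cases "?\<phi> s = 0")
        case True
        then show ?thesis using nn B(1) by (simp add: power_0_left)
      next
        case False
        then have "?\<phi> s = 1" by (simp add: hit_def)
        then show ?thesis using next_ldens_lower[of s n] lv[OF s] B(2)[of s] by simp
      qed
    qed
    \<comment> \<open>Concavity of the root moves the average inside, where the mean gain tends to
      \<open>0\<close>.\<close>
    also have "\<dots> \<le> avg ?O (\<lambda>s. ?\<phi> s * next_ldens s) + ?err n"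
    proof -
      have "avg ?O (\<lambda>s. sqrt (move_const u * lrefine_gain n (fst u) s)) \<le> sqrt (move_const u * avg ?O (lrefine_gain n (fst u)))"
        if u: "u \<in> ?J" for u
      proof -
        have "0 \<le> move_const u * lrefine_gain n (fst u) s" if "s \<in> ?O" for s
          using that lv u by (intro mult_nonneg_nonneg move_const_nonneg lrefine_gain_nonneg) auto
        then show ?thesis using avg_sqrt_le[of ?O "\<lambda>s. move_const u * lrefine_gain n (fst u) s"] by (simp add: avg_cmult)
      qed
      then show ?thesis by (simp add: avg_add avg_sum sum_mono)
    qed
    finally have "0 < avg ?O (\<lambda>s. ?\<phi> s * next_ldens s)" using elim(1) by simp
    then obtain s where "s \<in> ?O" "0 < ?\<phi> s * next_ldens s" using avg_pos_ex by blast
    then show ?case using hit_bounds[of "img c V s"] by (auto simp: zero_less_mult_iff intro!: bexI[of _ s])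
  qed
qed

end

end

section \<open>From indexed configurations to sets of nodes\<close>

lemma (in cone_limit) density_step_sets:
  assumes "\<forall>i\<in>I. G i \<subseteq> Lv i m \<and> finite (G i)" and pos: "ldens fst (Sigma I G) snd > 0"
  shows "\<exists>n\<ge>k. \<exists>\<sigma>. (\<forall>i\<in>I. \<forall>u\<in>G i. \<sigma> i u \<in> cone i u n) \<and> PiE I (\<lambda>i. \<sigma> i ` G i) \<subseteq> D \<and>
    ldens fst (Sigma I (\<lambda>i. \<Union>u\<in>G i. cone i (\<sigma> i u) (Suc n))) snd > 0"
proof -
  have G: "G i \<subseteq> Lv i m \<and> finite (G i)" if "i \<in> I" for i using assms(1) that by blast
  define V where "V = Sigma I G"
  have "finite V" unfolding V_def using finite_I G by (intro finite_SigmaI) auto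
  moreover have "fst v \<in> I" if "v \<in> V" for v using that by (auto simp: V_def)
  ultimately interpret blowup I Lv cone br child D U V "fst :: 'i \<times> 'a \<Rightarrow> 'i"
    by (intro blowup.intro cone_limit_axioms blowup_axioms.intro)
  have r: "snd v \<in> Lv (fst v) m" if "v \<in> V" for v using that G[of "fst v"] by (auto simp: V_def)
  have "\<forall>\<^sub>F n in U. \<exists>s\<in>box n fst V snd. hit (img fst V s) > 0 \<and> next_ldens s > 0"
    using r pos unfolding V_def[symmetric] by (rule density_step)
  \<comment> \<open>\<open>m \<le> n\<close> makes the cones of distinct nodes of level
    \<open>m\<close> disjoint at level \<open>n\<close>; \<open>k \<le> n\<close> will keep the
    levels growing.\<close>
  then have ev: "\<forall>\<^sub>F n in U. max k m \<le> n \<and> (\<exists>s\<in>box n fst V snd. hit (img fst V s) > 0 \<and> next_ldens s > 0)"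
    using eventually_ge[of "max k m"] by (intro eventually_conj)
  obtain n s where n: "max k m \<le> n" and s: "s \<in> box n fst V snd"
    and hit: "hit (img fst V s) > 0" and nxt: "next_ldens s > 0"
    using eventually_happens'[OF U_nontrivial ev] by blast
  define \<sigma> where "\<sigma> = (\<lambda>i u. s (i, u))"
  have \<sigma>: "\<sigma> i u \<in> cone i u n" if "i \<in> I" "u \<in> G i" for i u
    using s that by (auto simp: \<sigma>_def box_def V_def PiE_iff)
  have lv: "\<sigma> i u \<in> Lv i n" if "i \<in> I" "u \<in> G i" for i u
    using \<sigma>[OF that] cone_sub[OF that(1)] by (rule subsetD[rotated])
  have "img fst V s i = \<sigma> i ` G i" if "i \<in> I" for i
    using that by (auto simp: img_def V_def \<sigma>_def)
  then have "PiE I (\<lambda>i. \<sigma> i ` G i) = PiE I (img fst V s)" by (intro PiE_cong) auto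
  then have D: "PiE I (\<lambda>i. \<sigma> i ` G i) \<subseteq> D" using hit by (simp add: hit_def split: if_splits)
  let ?G' = "\<lambda>i. \<Union>u\<in>G i. cone i (\<sigma> i u) (Suc n)"
  let ?h = "\<lambda>w. (fst (fst w), child (fst (fst w)) (s (fst w)) (snd w))"
  have child: "bij_betw (child i (\<sigma> i u)) {..<br i} (cone i (\<sigma> i u) (Suc n))" if "i \<in> I" "u \<in> G i" for i u
    using that(1) lv[OF that] by (rule child_bij)
  \<comment> \<open>Copy \<open>j\<close> of \<open>(i, u)\<close> corresponds to successor number
    \<open>j\<close> of \<open>\<sigma> i u\<close>. Injectivity is disjointness of cones, applied
    first to the nodes \<open>\<sigma> i u\<close> and then to the nodes \<open>u\<close>.\<close>
  have "bij_betw ?h (Sigma V K_full) (Sigma I ?G')"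
    unfolding bij_betw_def
  proof
    show "inj_on ?h (Sigma V K_full)"
    proof (rule inj_onI)
      fix w w' assume w: "w \<in> Sigma V K_full" "w' \<in> Sigma V K_full" and eq: "?h w = ?h w'"
      obtain i u j where wd: "w = ((i, u), j)" by (metis surj_pair)
      obtain i' u' j' where wd': "w' = ((i', u'), j')" by (metis surj_pair)
      have i: "i = i'" "child i (\<sigma> i u) j = child i (\<sigma> i u') j'" using eq by (auto simp: wd wd' \<sigma>_def)
      have mem: "i \<in> I" "u \<in> G i" "u' \<in> G i" "j < br i" "j' < br i"
        using w i by (auto simp: wd wd' V_def K_full_def)
      have c: "child i (\<sigma> i u) j \<in> cone i (\<sigma> i u) (Suc n)" "child i (\<sigma> i u') j' \<in> cone i (\<sigma> i u') (Suc n)"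
        using child[OF mem(1,2)] child[OF mem(1,3)] mem by (auto simp: bij_betw_def)
      have "\<sigma> i u = \<sigma> i u'"
        using cone_disj[OF mem(1) lv[OF mem(1,2)] lv[OF mem(1,3)], of "Suc n"] c i by auto
      moreover have "u = u'"
      proof (rule ccontr)
        assume "u \<noteq> u'"
        moreover have "u \<in> Lv i m" "u' \<in> Lv i m" using G mem by auto
        ultimately have "cone i u n \<inter> cone i u' n = {}"
          using n by (intro cone_disj[OF mem(1)]) auto
        then show False using \<sigma>[OF mem(1,2)] \<sigma>[OF mem(1,3)] \<open>\<sigma> i u = \<sigma> i u'\<close> by auto
      qed
      moreover have "j = j'"
        using child[OF mem(1,2)] i mem \<open>u = u'\<close> by (auto simp: bij_betw_def inj_on_def)
      ultimately show "w = w'" by (simp add: wd wd' i)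
    qed
    show "?h ` Sigma V K_full = Sigma I ?G'"
    proof
      show "?h ` Sigma V K_full \<subseteq> Sigma I ?G'"
      proof
        fix y assume "y \<in> ?h ` Sigma V K_full"
        then obtain i u j where "i \<in> I" "u \<in> G i" "j < br i" "y = (i, child i (\<sigma> i u) j)"
          by (auto simp: V_def K_full_def \<sigma>_def)
        then show "y \<in> Sigma I ?G'" using child[of i u] by (auto simp: bij_betw_def)
      qed
      show "Sigma I ?G' \<subseteq> ?h ` Sigma V K_full"
      proof
        fix y assume "y \<in> Sigma I ?G'"
        then obtain i u x where iu: "i \<in> I" "u \<in> G i" "x \<in> cone i (\<sigma> i u) (Suc n)" "y = (i, x)" by auto
        then obtain j where "j < br i" "x = child i (\<sigma> i u) j" using child[of i u] by (auto simp: bij_betw_def)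
        then have "y = ?h ((i, u), j)" "((i, u), j) \<in> Sigma V K_full"
          using iu by (auto simp: \<sigma>_def V_def K_full_def)
        then show "y \<in> ?h ` Sigma V K_full" by blast
      qed
    qed
  qed
  from ldens_reindex[OF this, of "fst \<circ> fst" fst snd] nxt
  have "ldens fst (Sigma I ?G') snd > 0" by (simp add: next_ldens_def comp_def)
  with n \<sigma> D show ?thesis by (intro exI[of _ n] conjI exI[of _ \<sigma>]) auto
qed

text \<open>With one vertex per tree the grid is the single tuple \<open>y\<close>.\<close>

lemma (in cone_system) dens_roots:
  "dens N fst (Sigma I (\<lambda>i. {\<rho> i})) snd = avg (\<Pi>\<^sub>E i\<in>I. cone i (\<rho> i) N) (\<lambda>y. of_bool (y \<in> D))"
proof -
  have bij: "bij_betw fst (Sigma I (\<lambda>i. {\<rho> i})) I" by (force simp: bij_betw_def inj_on_def)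
  have "dens N fst (Sigma I (\<lambda>i. {\<rho> i})) snd = dens N fst (Sigma I (\<lambda>i. {\<rho> i})) (\<lambda>v. \<rho> (fst v))"
    by (intro dens_cong) auto
  also have "\<dots> = dens N id I \<rho>" by (rule dens_reindex[OF bij]) simp
  also have "\<dots> = avg (\<Pi>\<^sub>E i\<in>I. cone i (\<rho> i) N) (\<lambda>y. of_bool (y \<in> D))"
    unfolding dens_def box_def
  proof (rule avg_cong)
    fix y assume y: "y \<in> (\<Pi>\<^sub>E i\<in>I. cone i (\<rho> i) N)"
    have "PiE I (img id I y) = PiE I (\<lambda>i. {y i})" by (intro PiE_cong) (auto simp: img_def)
    also have "\<dots> = {y}" using y by (intro PiE_singleton) (auto simp: PiE_iff)
    finally show "hit (img id I y) = of_bool (y \<in> D)" by (simp add: hit_def)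
  qed simp
  finally show ?thesis .
qed

section \<open>Trees\<close>

text \<open>Both sides enumerate one set increasingly. If they first differed at \<open>k\<close>,
  the smaller of the two values would occur twice in one enumeration.\<close>

lemma enumerate_range_strict_mono:
  assumes n: "strict_mono (n :: nat \<Rightarrow> nat)"
  shows "enumerate (range n) k = n k"
proof (induction k rule: less_induct)
  case (less k)
  let ?e = "enumerate (range n)"
  have inf: "infinite (range n)" using n by (simp add: strict_mono_imp_inj_on range_inj_infinite)
  then have e: "strict_mono ?e" "range ?e = range n"
    by (rule strict_mono_enumerate, rule range_enumerate)
  obtain j where j: "n k = ?e j" using e(2) by blast
  obtain j' where j': "?e k = n j'" using e(2) by blast
  show ?case
  proof (rule linorder_cases[of j k])
    assume "j < k"
    then show ?thesis using less[of j] j n by (simp add: strict_mono_eq)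
  next
    assume "k < j"
    then have "n j' < n k" using j j' e(1) by (metis strict_mono_less)
    then have "j' < k" using n by (simp add: strict_mono_less)
    then show ?thesis using less[of j'] j' e(1) by (metis nat_neq_iff strict_mono_eq)
  qed (use j in simp)
qed

locale tree =
  fixes T :: "'a set" and lt :: "'a \<Rightarrow> 'a \<Rightarrow> bool"
  assumes tree: "is_tree T lt"
begin

abbreviation "len \<equiv> tree_length T lt"

definition tcone :: "'a \<Rightarrow> nat \<Rightarrow> 'a set" where
  "tcone t n = {x \<in> level T lt n. lt\<^sup>=\<^sup>= t x}"

lemma lt_irrefl: "x \<in> T \<Longrightarrow> \<not> lt x x"
  using tree by (auto simp: is_tree_def irreflp_on_def)

lemma lt_trans: "x \<in> T \<Longrightarrow> y \<in> T \<Longrightarrow> z \<in> T \<Longrightarrow> lt x y \<Longrightarrow> lt y z \<Longrightarrow> lt x z"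
  using tree transp_onD[of T lt x y z] by (auto simp: is_tree_def)

lemma le_trans: "x \<in> T \<Longrightarrow> y \<in> T \<Longrightarrow> z \<in> T \<Longrightarrow> lt\<^sup>=\<^sup>= x y \<Longrightarrow> lt\<^sup>=\<^sup>= y z \<Longrightarrow> lt\<^sup>=\<^sup>= x z"
  using lt_trans[of x y z] by auto

lemma finite_below: "x \<in> T \<Longrightarrow> finite {s \<in> T. lt s x}"
  using tree by (auto simp: is_tree_def)

lemma below_total: "x \<in> T \<Longrightarrow> s \<in> T \<Longrightarrow> t \<in> T \<Longrightarrow> lt\<^sup>=\<^sup>= s x \<Longrightarrow> lt\<^sup>=\<^sup>= t x \<Longrightarrow> lt s t \<or> s = t \<or> lt t s"
  using tree totalp_onD[of "{s \<in> T. lt s x}" lt s t] by (auto simp: is_tree_def)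

lemma len_less:
  assumes "s \<in> T" "x \<in> T" "lt s x"
  shows "len s < len x"
proof -
  have "{y \<in> T. lt y s} \<subset> {y \<in> T. lt y x}"
    using assms lt_trans[of _ s x] lt_irrefl[of s] by auto
  then show ?thesis unfolding tree_length_def using finite_below[OF assms(2)] by (rule psubset_card_mono[rotated])
qed

lemma le_same_len: "s \<in> T \<Longrightarrow> x \<in> T \<Longrightarrow> lt\<^sup>=\<^sup>= s x \<Longrightarrow> len s = len x \<Longrightarrow> s = x"
  using len_less[of s x] by auto

lemma ancestor_unique:
  assumes "x \<in> T" "s \<in> T" "t \<in> T" "lt\<^sup>=\<^sup>= s x" "lt\<^sup>=\<^sup>= t x" "len s = len t"
  shows "s = t"
  using below_total[OF assms(1-5)] len_less[of s t] len_less[of t s] assms by auto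

text \<open>The predecessors of \<open>x\<close> form a finite chain, so one of maximal length lies
  above all others. Hence \<open>x\<close> is exactly one longer than it, and the induction
  descends.\<close>

lemma ancestor_exists:
  assumes "x \<in> T" "m \<le> len x"
  shows "\<exists>s\<in>T. lt\<^sup>=\<^sup>= s x \<and> len s = m"
  using assms
proof (induction "len x" arbitrary: x rule: less_induct)
  case less
  show ?case
  proof (cases "m = len x")
    case True
    then show ?thesis using less by auto
  next
    case False
    let ?B = "{s \<in> T. lt s x}"
    have fin: "finite ?B" using less finite_below by blast
    have ne: "?B \<noteq> {}" using False less(3) unfolding tree_length_def by force
    have "Max (len ` ?B) \<in> len ` ?B" using fin ne by (intro Max_in) auto
    then obtain s where s: "s \<in> ?B" "Max (len ` ?B) = len s" by (rule imageE)
    have max: "len y \<le> len s" if "y \<in> ?B" for y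
      using Max_ge[of "len ` ?B" "len y"] fin that s(2) by simp
    have "y = s \<or> lt y s" if y: "y \<in> ?B" for y
      using below_total[of x y s] y s(1) less(2) max[OF y] len_less[of s y] by auto
    then have B: "?B = insert s {y \<in> T. lt y s}"
      using s(1) less(2) lt_trans[of _ s x] by auto
    have "card ?B = Suc (card {y \<in> T. lt y s})"
      unfolding B using s(1) lt_irrefl[of s] finite_below[of s] by simp
    then have "len x = Suc (len s)" by (simp add: tree_length_def)
    then obtain t where "t \<in> T" "lt\<^sup>=\<^sup>= t s" "len t = m"
      using less(1)[of s] s(1) False less(3) by auto
    then show ?thesis using s(1) less(2) lt_trans[of t s x] by auto
  qed
qed

text \<open>The ancestor of \<open>x\<close> at level \<open>k\<close> is comparable with
  \<open>t\<close>, as both lie below \<open>x\<close>, and by its length it cannot lie strictly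
  below \<open>t\<close>.\<close>

lemma tcone_UN:
  assumes "t \<in> level T lt m" "m \<le> k" "k \<le> n"
  shows "tcone t n = (\<Union>s\<in>tcone t k. tcone s n)"
proof
  show "tcone t n \<subseteq> (\<Union>s\<in>tcone t k. tcone s n)"
  proof
    fix x assume x: "x \<in> tcone t n"
    then have xT: "x \<in> T" "len x = n" "lt\<^sup>=\<^sup>= t x" by (auto simp: tcone_def level_def)
    then obtain s where s: "s \<in> T" "lt\<^sup>=\<^sup>= s x" "len s = k"
      using ancestor_exists[of x k] assms(3) by auto
    have t: "t \<in> T" "len t = m" using assms by (auto simp: level_def)
    have "lt\<^sup>=\<^sup>= t s"
      using below_total[OF xT(1) t(1) s(1) xT(3) s(2)] len_less[OF s(1) t(1)] s t assms by auto
    then show "x \<in> (\<Union>s\<in>tcone t k. tcone s n)" using s x by (auto simp: tcone_def level_def)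
  qed
  show "(\<Union>s\<in>tcone t k. tcone s n) \<subseteq> tcone t n"
  proof
    fix x assume "x \<in> (\<Union>s\<in>tcone t k. tcone s n)"
    then obtain s where "s \<in> tcone t k" "x \<in> tcone s n" by (rule UN_E)
    then show "x \<in> tcone t n"
      using assms(1) le_trans[of t s x] by (simp add: tcone_def level_def)
  qed
qed

lemma tcone_disj:
  assumes "s \<in> level T lt k" "s' \<in> level T lt k" "s \<noteq> s'"
  shows "tcone s n \<inter> tcone s' n = {}"
proof (rule equals0I)
  fix x assume "x \<in> tcone s n \<inter> tcone s' n"
  then show False
    using ancestor_unique[of x s s'] assms by (simp add: tcone_def level_def)
qed

lemma tcone_refl:
  assumes "t \<in> level T lt m"
  shows "tcone t m = {t}"
proof -
  have "x = t" if "x \<in> tcone t m" for x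
    using le_same_len[of t x] assms that by (simp add: tcone_def level_def)
  moreover have "t \<in> tcone t m" using assms by (simp add: tcone_def)
  ultimately show ?thesis by blast
qed

lemma tcone_imm_succ: "t \<in> level T lt m \<Longrightarrow> tcone t (Suc m) = imm_succ T lt t"
  by (auto simp: tcone_def level_def imm_succ_def)

lemma card_tcone:
  assumes b: "b > 0" "\<And>t. t \<in> T \<Longrightarrow> card (imm_succ T lt t) = b"
    and t: "t \<in> level T lt m" and "m \<le> n"
  shows "card (tcone t n) = b ^ (n - m)"
  using \<open>m \<le> n\<close>
proof (induction n rule: dec_induct)
  case base
  then show ?case using tcone_refl[OF t] by simp
next
  case (step n)
  have lv: "s \<in> level T lt n" "s \<in> T" if "s \<in> tcone t n" for s using that by (auto simp: tcone_def level_def)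
  have card: "card (tcone s (Suc n)) = b" if "s \<in> tcone t n" for s
    using lv[OF that] b by (simp add: tcone_imm_succ)
  have "card (tcone t n) > 0" using step b(1) by simp
  then have fin: "finite (tcone t n)" by (rule card_ge_0_finite)
  have fin': "finite (tcone s (Suc n))" if "s \<in> tcone t n" for s
    using card[OF that] b(1) by (intro card_ge_0_finite) simp
  have "card (\<Union>s\<in>tcone t n. tcone s (Suc n)) = (\<Sum>s\<in>tcone t n. card (tcone s (Suc n)))"
  proof (rule card_UN_disjoint[OF fin])
    show "\<forall>s\<in>tcone t n. finite (tcone s (Suc n))" using fin' by simp
    show "\<forall>s\<in>tcone t n. \<forall>s'\<in>tcone t n. s \<noteq> s' \<longrightarrow> tcone s (Suc n) \<inter> tcone s' (Suc n) = {}"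
      by (intro ballI impI tcone_disj[OF lv(1) lv(1)])
  qed
  also have "\<dots> = card (tcone t n) * b" using card by simp
  finally show ?case using tcone_UN[OF t, of n "Suc n"] step by (simp add: Suc_diff_le)
qed

lemma level_tcone:
  assumes "level T lt 0 = {\<rho>}"
  shows "level T lt n = tcone \<rho> n"
proof -
  have "lt\<^sup>=\<^sup>= \<rho> x" if "x \<in> T" for x
    using ancestor_exists[OF that, of 0] assms by (simp add: level_def set_eq_iff) metis
  then show ?thesis by (auto simp: tcone_def level_def)
qed

text \<open>Choosing one extension \<open>\<sigma> u\<close> of each immediate successor
  \<open>u\<close> is what condition (c) of a strong subtree demands; the sets \<open>F k\<close>
  then turn out to be the levels of their union.\<close>

lemma strong_subtree_of_levels:
  assumes n: "strict_mono n" and F0: "\<exists>x. F 0 = {x}"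
    and lv: "\<And>k. F k \<subseteq> level T lt (n k)"
    and step: "\<And>k. \<exists>\<sigma>. F (Suc k) = \<sigma> ` (\<Union>x\<in>F k. imm_succ T lt x) \<and>
      (\<forall>u\<in>(\<Union>x\<in>F k. imm_succ T lt x). lt\<^sup>=\<^sup>= u (\<sigma> u))"
  defines "S \<equiv> \<Union>k. F k"
  shows "strong_subtree T lt S" "has_level_set T lt S (range n)" "level S lt k = F k"
proof -
  have FT: "x \<in> T" "len x = n k" if "x \<in> F k" for x k using that lv by (auto simp: level_def)
  have ST: "S \<subseteq> T" using FT by (auto simp: S_def)
  have parent: "\<exists>y\<in>F k. lt y x" if x: "x \<in> F (Suc k)" for x k
  proof -
    obtain y u where u: "y \<in> F k" "u \<in> imm_succ T lt y" "lt\<^sup>=\<^sup>= u x" using step[of k] x by auto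
    have "lt\<^sup>=\<^sup>= y x" using u FT[OF u(1)] FT[OF x] le_trans[of y u x] by (auto simp: imm_succ_def)
    moreover have "n k < n (Suc k)" using n by (simp add: strict_mono_def)
    ultimately show ?thesis using u(1) FT[OF x] FT[OF u(1)] by auto
  qed
  have anc: "\<exists>y\<in>F j. lt y x" if "x \<in> F k" "j < k" for x j k
    using that
  proof (induction k arbitrary: x)
    case (Suc k)
    obtain y where y: "y \<in> F k" "lt y x" using parent Suc by blast
    show ?case
    proof (cases "j = k")
      case False
      then obtain z where "z \<in> F j" "lt z y" using Suc y by (metis less_SucE)
      then show ?thesis
        using y(2) lt_trans[of z y x] FT(1)[OF y(1)] FT(1)[OF Suc.prems(1)] FT(1)[of z j] by auto
    qed (use y in auto)
  qed simp
  have lenS: "tree_length S lt x = k" if x: "x \<in> F k" for x k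
  proof -
    \<comment> \<open>Distinct predecessors of \<open>x\<close> have distinct lengths in
      \<open>T\<close>, and every \<open>F j\<close> with \<open>j < k\<close> supplies one.\<close>
    have "bij_betw len {s \<in> S. lt s x} (n ` {..<k})"
      unfolding bij_betw_def
    proof
      show "inj_on len {s \<in> S. lt s x}"
        using ancestor_unique[OF FT(1)[OF x]] ST by (auto simp: inj_on_def subset_iff)
      show "len ` {s \<in> S. lt s x} = n ` {..<k}"
      proof
        show "len ` {s \<in> S. lt s x} \<subseteq> n ` {..<k}"
        proof
          fix l assume "l \<in> len ` {s \<in> S. lt s x}"
          then obtain s j where s: "s \<in> F j" "lt s x" "l = len s" by (auto simp: S_def)
          then have "n j < n k" using len_less[of s x] FT[OF s(1)] FT[OF x] by simp
          then show "l \<in> n ` {..<k}" using s FT n by (auto simp: strict_mono_less)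
        qed
        show "n ` {..<k} \<subseteq> len ` {s \<in> S. lt s x}"
        proof
          fix l assume "l \<in> n ` {..<k}"
          then obtain j where j: "j < k" "l = n j" by auto
          obtain y where y: "y \<in> F j" "lt y x" using anc[OF x j(1)] by blast
          then have "len y = l" "y \<in> S" using FT[OF y(1)] j by (auto simp: S_def)
          then show "l \<in> len ` {s \<in> S. lt s x}" using y(2) by auto
        qed
      qed
    qed
    then have "card {s \<in> S. lt s x} = card (n ` {..<k})" by (rule bij_betw_same_card)
    then show ?thesis
      using n by (simp add: tree_length_def card_image inj_on_def strict_mono_eq)
  qed
  then show levelS: "level S lt k = F k" for k by (auto simp: level_def S_def)
  have inf: "infinite (range n)" using n by (simp add: strict_mono_imp_inj_on range_inj_infinite)
  have enum: "enumerate (range n) k = n k" for k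
    using n by (rule enumerate_range_strict_mono)
  show hl: "has_level_set T lt S (range n)"
    using inf lv by (simp add: has_level_set_def levelS enum)
  have ext: "\<exists>!s'. s' \<in> imm_succ S lt s \<and> lt\<^sup>=\<^sup>= t s'" if s: "s \<in> S" and t: "t \<in> imm_succ T lt s" for s t
  proof -
    obtain k where k: "s \<in> F k" using s by (auto simp: S_def)
    have tT: "t \<in> T" "lt\<^sup>=\<^sup>= s t" "len t = Suc (n k)" using t FT[OF k] by (auto simp: imm_succ_def)
    obtain \<sigma> where \<sigma>: "F (Suc k) = \<sigma> ` (\<Union>x\<in>F k. imm_succ T lt x)"
      "\<And>u. u \<in> (\<Union>x\<in>F k. imm_succ T lt x) \<Longrightarrow> lt\<^sup>=\<^sup>= u (\<sigma> u)" using step[of k] by auto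
    have succ: "s' \<in> imm_succ S lt s \<longleftrightarrow> s' \<in> F (Suc k) \<and> lt\<^sup>=\<^sup>= s s'" for s'
      using levelS[of "Suc k"] lenS[OF k] by (auto simp: imm_succ_def level_def)
    have \<sigma>t: "\<sigma> t \<in> F (Suc k)" "lt\<^sup>=\<^sup>= t (\<sigma> t)" using \<sigma> t k by auto
    then have ex: "\<sigma> t \<in> imm_succ S lt s"
      unfolding succ using le_trans[of s t "\<sigma> t"] FT[OF k] FT[OF \<sigma>t(1)] tT by blast
    \<comment> \<open>\<open>s'\<close> equals \<open>\<sigma> u\<close> for some \<open>u\<close>,
      and \<open>u\<close> and \<open>t\<close> are ancestors of \<open>s'\<close> of the same
      length.\<close>
    have un: "s' = \<sigma> t" if s': "s' \<in> imm_succ S lt s" "lt\<^sup>=\<^sup>= t s'" for s'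
    proof -
      have s'F: "s' \<in> F (Suc k)" using s' succ by blast
      then obtain x u where u: "x \<in> F k" "u \<in> imm_succ T lt x" "s' = \<sigma> u" using \<sigma>(1) by auto
      have "lt\<^sup>=\<^sup>= u s'" unfolding u(3) using u by (intro \<sigma>(2)) (rule UN_I)
      moreover have "u \<in> T" "len u = Suc (n k)" using u(2) FT[OF u(1)] by (simp_all add: imm_succ_def)
      ultimately have "u = t" using ancestor_unique[of s' u t] FT(1)[OF s'F] tT(1,3) s'(2) by simp
      then show ?thesis using u by simp
    qed
    show ?thesis using ex \<sigma>t(2) un by (intro ex1I[of _ "\<sigma> t"] conjI) (assumption | elim conjE)+
  qed
  have "card (level S lt 0) = 1" using F0 by (auto simp: levelS)
  then show "strong_subtree T lt S"
    unfolding strong_subtree_def uniquely_rooted_def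
    by (intro conjI ballI ST exI[of _ "range n"] hl ext)
qed

end

section \<open>Building the strong subtrees level by level\<close>

theorem theorem2:
  fixes d :: nat
    and T :: "nat \<Rightarrow> 'a set"
    and lt :: "nat \<Rightarrow> 'a \<Rightarrow> 'a \<Rightarrow> bool"
    and D :: "(nat \<Rightarrow> 'a) set"
  assumes "d \<ge> 1"
    and "\<forall>i\<in>{1..d}. homogeneous_tree (T i) (lt i)"
    and "D \<subseteq> level_product d T lt"
    and "limsup (\<lambda>n. ereal (real (card (D \<inter> level_prod_at d T lt n)) /
                             real (card (level_prod_at d T lt n)))) > 0"
  shows "\<exists>S L. (\<forall>i\<in>{1..d}. strong_subtree (T i) (lt i) (S i) \<and>
                            has_level_set (T i) (lt i) (S i) L) \<and>
               level_product d S lt \<subseteq> D"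
proof -
  define I where "I = {1..d}"
  define Lv where "Lv = (\<lambda>i. level (T i) (lt i))"
  define cone where "cone = (\<lambda>i. tree.tcone (T i) (lt i))"
  have tr: "tree (T i) (lt i)" if "i \<in> I" for i
    using assms(2) that by (auto simp: I_def homogeneous_tree_def tree_def)
  have "\<forall>i\<in>I. \<exists>b. b \<ge> 2 \<and> (\<forall>t\<in>T i. card (imm_succ (T i) (lt i) t) = b)"
    using assms(2) by (auto simp: I_def homogeneous_tree_def)
  then obtain b where b2: "\<And>i. i \<in> I \<Longrightarrow> b i \<ge> (2::nat)"
    and b: "\<And>i t. i \<in> I \<Longrightarrow> t \<in> T i \<Longrightarrow> card (imm_succ (T i) (lt i) t) = b i"
    by (auto dest!: bchoice)
  have b0: "b i > 0" if "i \<in> I" for i using b2[OF that] by simp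
  have "\<forall>i\<in>I. \<exists>x. Lv i 0 = {x}"
    using assms(2) by (auto simp: I_def homogeneous_tree_def uniquely_rooted_def Lv_def card_1_singleton_iff)
  then obtain \<rho> where \<rho>: "\<And>i. i \<in> I \<Longrightarrow> Lv i 0 = {\<rho> i}" by (auto dest!: bchoice)
  have LvT: "t \<in> T i" if "t \<in> Lv i m" for i t m using that by (simp add: Lv_def level_def)
  have succ: "cone i t (Suc m) = imm_succ (T i) (lt i) t" if "i \<in> I" "t \<in> Lv i m" for i t m
    using tree.tcone_imm_succ[OF tr[OF that(1)], of t m] that(2) by (simp add: cone_def Lv_def)
  define child where "child = (\<lambda>i t. SOME f. bij_betw f {..<b i} (imm_succ (T i) (lt i) t))"
  have child: "bij_betw (child i t) {..<b i} (imm_succ (T i) (lt i) t)" if "i \<in> I" "t \<in> T i" for i t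
  proof -
    have "finite (imm_succ (T i) (lt i) t)" using b[OF that] b0[OF that(1)] by (simp add: card_ge_0_finite)
    from ex_bij_betw_nat_finite[OF this] have "\<exists>f. bij_betw f {..<b i} (imm_succ (T i) (lt i) t)"
      by (simp add: b[OF that] atLeast0LessThan)
    then show ?thesis unfolding child_def by (rule someI_ex)
  qed
  interpret cone_system I Lv cone b child D
  proof
    show "finite I" by (simp add: I_def)
    show "b i > 0" if "i \<in> I" for i by (rule b0[OF that])
    show "card (cone i t n) = b i ^ (n - m)" if "i \<in> I" "t \<in> Lv i m" "m \<le> n" for i t m n
      using tree.card_tcone[OF tr[OF that(1)] b0[OF that(1)] b[OF that(1)], of t m n] that(2,3)
      by (simp add: cone_def Lv_def)
    show "cone i t n \<subseteq> Lv i n" if "i \<in> I" for i t n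
      by (auto simp: cone_def Lv_def tree.tcone_def[OF tr[OF that]])
    show "cone i t n = (\<Union>s\<in>cone i t k. cone i s n)"
      if "i \<in> I" "t \<in> Lv i m" "m \<le> k" "k \<le> n" for i t m k n
      using tree.tcone_UN[OF tr[OF that(1)], of t m k n] that by (simp add: cone_def Lv_def)
    show "cone i s n \<inter> cone i s' n = {}"
      if "i \<in> I" "s \<in> Lv i k" "s' \<in> Lv i k" "k \<le> n" "s \<noteq> s'" for i s k s' n
      using tree.tcone_disj[OF tr[OF that(1)], of s k s' n] that by (simp add: cone_def Lv_def)
    show "cone i t m = {t}" if "i \<in> I" "t \<in> Lv i m" for i t m
      using tree.tcone_refl[OF tr[OF that(1)], of t m] that by (simp add: cone_def Lv_def)
    show "bij_betw (child i t) {..<b i} (cone i t (Suc m))" if "i \<in> I" "t \<in> Lv i m" for i t m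
      using child[OF that(1) LvT[OF that(2)]] succ[OF that] by simp
  qed
  define dn where "dn = (\<lambda>n. real (card (D \<inter> level_prod_at d T lt n)) / real (card (level_prod_at d T lt n)))"
  obtain \<epsilon> where \<epsilon>: "0 < \<epsilon>" "ereal \<epsilon> < limsup (\<lambda>n. ereal (dn n))"
    using ereal_dense2[OF assms(4)] by (auto simp: dn_def)
  have "\<exists>\<^sub>F n in sequentially. \<epsilon> < dn n"
  proof (rule ccontr)
    assume "\<not> (\<exists>\<^sub>F n in sequentially. \<epsilon> < dn n)"
    then have "\<forall>\<^sub>F n in sequentially. ereal (dn n) \<le> ereal \<epsilon>" by (simp add: not_frequently not_less)
    then have "limsup (\<lambda>n. ereal (dn n)) \<le> ereal \<epsilon>" by (rule Limsup_bounded)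
    then show False using \<epsilon>(2) by simp
  qed
  \<comment> \<open>Densities above \<epsilon> occur infinitely often, so restricting
    \<open>sequentially\<close> to these levels gives a nontrivial filter; \<open>U\<close> is taken
    below it.\<close>
  then have "inf sequentially (principal {n. \<epsilon> < dn n}) \<noteq> bot"
    by (simp add: frequently_def trivial_limit_def eventually_inf_principal)
  from exists_ultrafilter[OF this] obtain U
    where U: "U \<le> inf sequentially (principal {n. \<epsilon> < dn n})" "U \<noteq> bot"
      "\<forall>P. eventually P U \<or> eventually (\<lambda>x. \<not> P x) U"
    by (elim exE conjE)
  interpret cone_limit I Lv cone b child D U
    using U by unfold_locales auto
  have evU: "\<forall>\<^sub>F n in U. \<epsilon> < dn n"
    using U(1) by (rule filter_leD) (simp add: eventually_inf_principal)
  let ?next = "\<lambda>F n i. \<Union>x\<in>F i. cone i x (Suc n)"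
  \<comment> \<open>The roots form the first configuration: its densities are those of
    \<open>D\<close>, which exceed \<epsilon> along \<open>U\<close>.\<close>
  have root: "ldens fst (Sigma I (\<lambda>i. {\<rho> i})) snd > 0"
  proof -
    have "dens N fst (Sigma I (\<lambda>i. {\<rho> i})) snd = dn N" for N
    proof -
      have "(\<Pi>\<^sub>E i\<in>I. cone i (\<rho> i) N) = level_prod_at d T lt N"
        unfolding level_prod_at_def I_def[symmetric] cone_def
        using tree.level_tcone[OF tr] \<rho> by (intro PiE_cong) (simp add: Lv_def)
      moreover have "finite (level_prod_at d T lt N)"
      proof -
        have "finite (level (T i) (lt i) N)" if "i \<in> I" for i
          using finite_cone[of i "\<rho> i" 0 N] tree.level_tcone[OF tr[OF that], of "\<rho> i" N] \<rho>[OF that] that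
          by (simp add: cone_def Lv_def)
        then show ?thesis unfolding level_prod_at_def I_def[symmetric] using finite_I by (intro finite_PiE) auto
      qed
      ultimately show ?thesis
        unfolding dens_roots by (simp add: avg_def dn_def sum_of_bool_eq Int_def conj_commute)
    qed
    then have "\<epsilon> \<le> ldens fst (Sigma I (\<lambda>i. {\<rho> i})) snd"
      using evU U(2) by (intro tendsto_lowerbound[OF ldens_tendsto]) (auto elim: eventually_mono)
    then show ?thesis using \<epsilon> by simp
  qed
  \<comment> \<open>A state is a level \<open>n\<close> with finite sets \<open>F i\<close> of nodes
    there, the future level \<open>k\<close> of the subtrees. Positive density is required not of
    \<open>F\<close> but of the successors of its nodes, above which the next level is
    chosen.\<close>
  define P where "P = (\<lambda>k (n, F). (k = (0::nat) \<longrightarrow> (\<forall>i\<in>I. \<exists>x. F i = {x})) \<and>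
    (\<forall>i\<in>I. F i \<subseteq> Lv i n \<and> finite (F i)) \<and> PiE I F \<subseteq> D \<and> ldens fst (Sigma I (?next F n)) snd > 0)"
  define Q where "Q = (\<lambda>(k::nat) (n, F) (n', F'). n < n' \<and>
    (\<forall>i\<in>I. \<exists>\<sigma>. F' i = \<sigma> ` ?next F n i \<and> (\<forall>u\<in>?next F n i. \<sigma> u \<in> cone i u n')))"
  have "\<exists>X. \<forall>k. P k (X k) \<and> Q k (X k) (X (Suc k))"
  proof (rule dependent_nat_choice)
    have "\<forall>i\<in>I. {\<rho> i} \<subseteq> Lv i 0 \<and> finite {\<rho> i}" using \<rho> by auto
    \<comment> \<open>Level \<open>0\<close> is chosen above the roots themselves, so each of its
      sets is a singleton.\<close>
    from density_step_sets[OF this root, of 0] obtain n \<sigma> where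
      \<sigma>: "\<And>i. i \<in> I \<Longrightarrow> \<sigma> i (\<rho> i) \<in> cone i (\<rho> i) n"
      and D: "PiE I (\<lambda>i. {\<sigma> i (\<rho> i)}) \<subseteq> D"
      and pos: "ldens fst (Sigma I (?next (\<lambda>i. {\<sigma> i (\<rho> i)}) n)) snd > 0"
      by auto
    have "\<sigma> i (\<rho> i) \<in> Lv i n" if "i \<in> I" for i using \<sigma>[OF that] cone_sub[OF that] by blast
    then have "P 0 (n, \<lambda>i. {\<sigma> i (\<rho> i)})" using D pos by (simp add: P_def)
    then show "\<exists>x. P 0 x" by blast
  next
    fix x k assume Px: "P k x"
    obtain n F where x: "x = (n, F)" by (metis surj_pair)
    have F: "\<And>i. i \<in> I \<Longrightarrow> F i \<subseteq> Lv i n \<and> finite (F i)"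
      and pos: "ldens fst (Sigma I (?next F n)) snd > 0"
      using Px by (auto simp: P_def x)
    have G: "?next F n i \<subseteq> Lv i (Suc n) \<and> finite (?next F n i)" if "i \<in> I" for i
    proof
      show "?next F n i \<subseteq> Lv i (Suc n)" using cone_sub[OF that] by (intro UN_least)
      have "finite (cone i x (Suc n))" if x: "x \<in> F i" for x
        using finite_cone[OF \<open>i \<in> I\<close>, of x n "Suc n"] F[OF \<open>i \<in> I\<close>] x by auto
      then show "finite (?next F n i)" using F[OF that] by (intro finite_UN_I) auto
    qed
    then have "\<forall>i\<in>I. ?next F n i \<subseteq> Lv i (Suc n) \<and> finite (?next F n i)" by (rule ballI)
    \<comment> \<open>The bound \<open>Suc n\<close> makes the levels strictly increasing.\<close>
    from density_step_sets[OF this pos, of "Suc n"] obtain n' \<sigma> where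
      n': "n' \<ge> Suc n" and \<sigma>: "\<forall>i\<in>I. \<forall>u\<in>?next F n i. \<sigma> i u \<in> cone i u n'"
      and D: "PiE I (\<lambda>i. \<sigma> i ` ?next F n i) \<subseteq> D"
      and pos': "ldens fst (Sigma I (\<lambda>i. \<Union>u\<in>?next F n i. cone i (\<sigma> i u) (Suc n'))) snd > 0"
      by (elim exE conjE)
    define F' where "F' = (\<lambda>i. \<sigma> i ` ?next F n i)"
    have "F' i \<subseteq> Lv i n' \<and> finite (F' i)" if "i \<in> I" for i
      unfolding F'_def
    proof
      show "\<sigma> i ` ?next F n i \<subseteq> Lv i n'"
        using \<sigma> cone_sub[OF that] that by (intro image_subsetI) (meson subsetD)
      show "finite (\<sigma> i ` ?next F n i)" using G[OF that] by simp
    qed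
    moreover have "?next F' n' = (\<lambda>i. \<Union>u\<in>?next F n i. cone i (\<sigma> i u) (Suc n'))"
      unfolding F'_def by (rule ext) (simp only: image_image)
    ultimately have "P (Suc k) (n', F')" using D pos' by (simp add: P_def F'_def)
    moreover have "Q k x (n', F')"
      using n' \<sigma> by (auto simp: Q_def x F'_def intro!: exI[of _ "\<sigma> _"])
    ultimately show "\<exists>y. P (Suc k) y \<and> Q k x y" by blast
  qed
  then obtain X where X: "\<And>k. P k (X k)" "\<And>k. Q k (X k) (X (Suc k))" by blast
  define n where "n = (\<lambda>k. fst (X k))"
  define F where "F = (\<lambda>k. snd (X k))"
  have P: "P k (n k, F k)" and Q: "Q k (n k, F k) (n (Suc k), F (Suc k))" for k
    using X[of k] by (simp_all add: n_def F_def)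
  have mono: "strict_mono n" using Q by (intro strict_monoI_Suc) (simp add: Q_def)
  have F0: "\<exists>x. F 0 i = {x}" if "i \<in> I" for i using P[of 0] that by (simp add: P_def)
  have Flv: "F k i \<subseteq> level (T i) (lt i) (n k)" if "i \<in> I" for i k
    using P[of k] that by (simp add: P_def Lv_def)
  have step: "\<exists>\<sigma>. F (Suc k) i = \<sigma> ` (\<Union>x\<in>F k i. imm_succ (T i) (lt i) x) \<and>
      (\<forall>u\<in>(\<Union>x\<in>F k i. imm_succ (T i) (lt i) x). (lt i)\<^sup>=\<^sup>= u (\<sigma> u))" if i: "i \<in> I" for i k
  proof -
    have eq: "?next (F k) (n k) i = (\<Union>x\<in>F k i. imm_succ (T i) (lt i) x)"
      using Flv[OF i, of k] succ[OF i] by (intro SUP_cong) (auto simp: Lv_def)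
    have le: "(lt i)\<^sup>=\<^sup>= u v" if "v \<in> cone i u m" for u v m
      using that by (simp add: cone_def tree.tcone_def[OF tr[OF i]])
    obtain \<sigma> where \<sigma>: "F (Suc k) i = \<sigma> ` ?next (F k) (n k) i"
      "\<forall>u\<in>?next (F k) (n k) i. \<sigma> u \<in> cone i u (n (Suc k))"
      using Q[of k] i by (auto simp: Q_def)
    have "(lt i)\<^sup>=\<^sup>= u (\<sigma> u)" if "u \<in> ?next (F k) (n k) i" for u
      using \<sigma>(2) that by (intro le[of "\<sigma> u" u]) (rule bspec)
    then show ?thesis using \<sigma>(1) unfolding eq by blast
  qed
  define S where "S = (\<lambda>i. \<Union>k. F k i)"
  have S: "strong_subtree (T i) (lt i) (S i)" "has_level_set (T i) (lt i) (S i) (range n)"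
    "level (S i) (lt i) k = F k i" if "i \<in> I" for i k
    unfolding S_def
    using tree.strong_subtree_of_levels[of "T i" "lt i" n "\<lambda>k. F k i", OF tr[OF that] mono F0[OF that] Flv[OF that] step[OF that]]
    by simp_all
  have "level_prod_at d S lt k \<subseteq> D" for k
  proof -
    \<comment> \<open>Level \<open>k\<close> of \<open>S i\<close> is \<open>F k i\<close>, so this
      is the grid that \<open>P\<close> keeps inside \<open>D\<close>.\<close>
    have "level_prod_at d S lt k = PiE I (F k)"
      unfolding level_prod_at_def I_def[symmetric] using S(3) by (intro PiE_cong)
    then show ?thesis using P[of k] by (simp add: P_def)
  qed
  then have "level_product d S lt \<subseteq> D" by (auto simp: level_product_def)
  then show ?thesis using S(1,2) unfolding I_def by (intro exI[of _ S] exI[of _ "range n"]) simp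
qed

end
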